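(* Let $M$ be a safe closed term of $\lambda LL$. Then every maximal safe-reduction sequence starting from $M$ ends in a strong value $W$ and contains at most $\mathcal W(M)$ numeric steps. If moreover $M$ has ground type (its type contains no $\multimap$), then $W$ is a $\beta$-normal form.
   Context: **Calculus $\lambda LL$.** Fix function symbols $\underline f$ with arities $n\ge 1$, each denoting a differentiable $f:\mathbb R^n\to\mathbb R$. Types: $A,B::=\mathbb R\mid A\multimap B\mid 1\mid A\otimes B\mid\top\mid A\& B\mid {!A}$. Each variable has a type fixed once and for all. Patterns: $p,q::=x\mid {!x}\mid ()\mid (p,q)\mid\langle p,q\rangle$, with no variable occurring twice; if $x$ has type $A$ then pattern $x$ has type $A$ and pattern $!x$ has type $!A$; $()$ has type $1$; $(p,q)$ has type $A\otimes B$ and $\langle p,q\rangle$ type $A\& B$ when $p:A$, $q:B$. Patterns $!x$ are called exponential. An environment is a finite set of typed patterns with pairwise disjoint variables; $!\Gamma$ denotes an environment all of whose patterns are exponential; the comma is union of environments having no variable in common. Terms (up to $\alpha$-equivalence): $M,N::=x\mid {!M}\mid\lambda p.M\mid MN\mid ()\mid (M,N)\mid\langle\rangle\mid\langle M,N\rangle\mid\underline r\ (r\in\mathbb R)\mid\underline f\mid\dot+\mid\dot*$. All terms are well-typed. Typing rules: - $x:A\vdash x:A$; $\;!x:{!A}\vdash x:A$; - from $!\Gamma\vdash M:A$ infer $!\Gamma\vdash {!M}:{!A}$; from $\Delta\vdash M:B$ infer $!x:{!A},\Delta\vdash M:B$; - from $p:A,\Delta\vdash M:B$ infer $\Delta\vdash\lambda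 p.M:A\multimap B$; - from $!\Gamma_1,\Delta_1\vdash M:A\multimap B$ and $!\Gamma_2,\Delta_2\vdash N:A$ infer $!\Gamma_1\cup{!\Gamma_2},\Delta_1,\Delta_2\vdash MN:B$; - $\vdash ():1$; from $\Delta\vdash M:B$ infer $():1,\Delta\vdash M:B$; - from $!\Gamma_1,\Delta_1\vdash M:A$ and $!\Gamma_2,\Delta_2\vdash N:B$ infer $!\Gamma_1\cup{!\Gamma_2},\Delta_1,\Delta_2\vdash(M,N):A\otimes B$; from $p:A,q:B,\Delta\vdash M:C$ infer $(p,q):A\otimes B,\Delta\vdash M:C$; - from $\Delta\vdash M_1:A_1$ and $\Delta\vdash M_2:A_2$ infer $\Delta\vdash\langle M_1,M_2\rangle:A_1\& A_2$; for $i\in\{1,2\}$, from $p_i:A_i,\Delta\vdash M:B$ infer $\langle p_1,p_2\rangle:A_1\& A_2,\Delta\vdash M:B$; $\Delta\vdash\langle\rangle:\top$ for any $\Delta$; - $\vdash\underline r:\mathbb R$; $\Delta\vdash\underline 0:\mathbb R$ for any $\Delta$; $\vdash\underline f:({!\mathbb R}\otimes\dots\otimes{!\mathbb R})\multimap{!\mathbb R}$ ($n$ factors); $\vdash\dot+:(\mathbb R\&\mathbb R)\multimap\mathbb R$; $\vdash\dot*:\mathbb R\multimap\mathbb R\multimap\mathbb R$. **$\beta$-reduction.** Values for a pattern: any term of type $A$ is a value for a variable $x:A$; $()$ is the value for $()$; $!M$ (any $M$) is a value for $!x$; $(V_1,V_2)$ (resp. $\langle V_1,V_2\rangle$) is a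 value for $(p_1,p_2)$ (resp. $\langle p_1,p_2\rangle$) if each $V_i$ is a value for $p_i$. Substitution: $M\{V/x\}$ is capture-avoiding substitution, $M\{()/()\}=M$, $M\{!N/!x\}=M\{N/x\}$, $M\{(V_1,V_2)/(p_1,p_2)\}=M\{\langle V_1,V_2\rangle/\langle p_1,p_2\rangle\}=M\{V_1/p_1\}\{V_2/p_2\}$. The relation $\rightarrow$ is the closure under all one-hole term contexts of: $(\lambda p.M)V\rightarrow M\{V/p\}$ for $V$ a value for $p$; and the three kinds of *numeric steps*: $\underline f(!\underline{r_1},\dots,!\underline{r_n})\rightarrow{!\underline{f(r_1,\dots,r_n)}}$; $\dot+\langle\underline{r_1},\underline{r_2}\rangle\rightarrow\underline{r_1+r_2}$; $\dot*\,\underline{r_1}\,\underline{r_2}\rightarrow\underline{r_1\cdot r_2}$. A $\beta$-normal form is a term with no $\rightarrow$-successor. **Strong values:** $W::=x\mid\underline r\mid\underline f\mid\dot+\mid\dot*\mid\lambda p.M\mid ()\mid(W_1,W_2)\mid\langle\rangle\mid\langle W_1,W_2\rangle\mid{!W}\mid\dot* W$ (with $M$ arbitrary). **Safe reduction** is the closure under all one-hole term contexts of the numeric rules together with $(\lambda p.M)W\to M\{W/p\}$ for $W$ a *closed strong value* (in place of the rule for arbitrary values). **Workload.** $\mathcal W(A)$ is the number of occurrences of $\mathbb R$ in the type $A$ not under a $!$. On terms: $\mathcal W(\underline f)=\mathcal W(\dot+)=\mathcal W(\dot* )=1$; $\mathcal W(x)=\mathcal W(!M)=\mathcal W(())=\mathcal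 W(\langle\rangle)=\mathcal W(\underline r)=0$; $\mathcal W(\lambda p.M)=\mathcal W(M)+\sum_{x:A\,\in\,FV(p)\setminus FV(M)}\mathcal W(A)$; $\mathcal W(MN)=\mathcal W((M,N))=\mathcal W(\langle M,N\rangle)=\mathcal W(M)+\mathcal W(N)$. **Safe term.** A variable is ground if its type contains no $\multimap$. A term $M$ is safe if (i) for every subterm $!M'$ of $M$, $\mathcal W(M')=0$; (ii) for every subterm $\langle M_1,M_2\rangle$ of $M$, $FV(M_1)\cap FV(M_2)$ contains only ground variables. *)

theory Defs
  imports "HOL-Library.Extended_Nat" "HOL-Analysis.L2_Norm"
begin

datatype ty =
    TReal
  | TLolli ty ty
  | TOne
  | TTensor ty ty
  | TTop
  | TWith ty ty
  | TBang ty

fun ground :: "ty \<Rightarrow> bool" where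
  "ground TReal = True"
| "ground (TLolli A B) = False"
| "ground TOne = True"
| "ground (TTensor A B) = (ground A \<and> ground B)"
| "ground TTop = True"
| "ground (TWith A B) = (ground A \<and> ground B)"
| "ground (TBang A) = ground A"

text \<open>Each variable carries its type, and there are infinitely many variables of each type.\<close>

type_synonym var = "nat \<times> ty"

datatype 'v pat =
    PVar 'v
  | PBang 'v
  | PUnit
  | PPair "'v pat" "'v pat"
  | PWith "'v pat" "'v pat"

fun pvars :: "'v pat \<Rightarrow> 'v list" where
  "pvars (PVar x) = [x]"
| "pvars (PBang x) = [x]"
| "pvars PUnit = []"
| "pvars (PPair p q) = pvars p @ pvars q"
| "pvars (PWith p q) = pvars p @ pvars q"

text \<open>The type \<^typ>\<open>var pat\<close> also contains non-linear trees; the patterns of the calculus are those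
  satisfying the following predicate.\<close>

definition pattern :: "var pat \<Rightarrow> bool" where
  "pattern p \<longleftrightarrow> distinct (pvars p)"

fun ptype :: "var pat \<Rightarrow> ty" where
  "ptype (PVar x) = snd x"
| "ptype (PBang x) = TBang (snd x)"
| "ptype PUnit = TOne"
| "ptype (PPair p q) = TTensor (ptype p) (ptype q)"
| "ptype (PWith p q) = TWith (ptype p) (ptype q)"

text \<open>
  Locally nameless representation: free variables are named, and \<open>BVar k j\<close> is the \<open>j\<close>-th variable
  (from the left) of the pattern of the \<open>k\<close>-th enclosing abstraction, counted from the inside. The
  binder only keeps the shape of its pattern and the types of its variables. The abstraction
  \<open>\<lambda>p. M\<close> over a named pattern is \<open>lam p M\<close> below, so that \<open>\<alpha>\<close>-equivalent terms are equal, and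
  the terms of the calculus are the elements satisfying \<open>lc\<close>.
\<close>

datatype 'f trm =
    FVar var
  | BVar nat nat
  | Bang "'f trm"
  | Lam "ty pat" "'f trm"
  | App "'f trm" "'f trm"
  | Unit
  | Pair "'f trm" "'f trm"
  | WUnit
  | WPair "'f trm" "'f trm"
  | Num real
  | Fn 'f
  | Plus
  | Times

fun pos :: "'v \<Rightarrow> 'v list \<Rightarrow> nat" where
  "pos x [] = 0"
| "pos x (y # ys) = (if x = y then 0 else Suc (pos x ys))"

fun close :: "nat \<Rightarrow> var list \<Rightarrow> 'f trm \<Rightarrow> 'f trm" where
  "close k xs (FVar x) = (if x \<in> set xs then BVar k (pos x xs) else FVar x)"
| "close k xs (BVar i j) = BVar i j"
| "close k xs (Bang M) = Bang (close k xs M)"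
| "close k xs (Lam P M) = Lam P (close (Suc k) xs M)"
| "close k xs (App M N) = App (close k xs M) (close k xs N)"
| "close k xs Unit = Unit"
| "close k xs (Pair M N) = Pair (close k xs M) (close k xs N)"
| "close k xs WUnit = WUnit"
| "close k xs (WPair M N) = WPair (close k xs M) (close k xs N)"
| "close k xs (Num r) = Num r"
| "close k xs (Fn f) = Fn f"
| "close k xs Plus = Plus"
| "close k xs Times = Times"

definition lam :: "var pat \<Rightarrow> 'f trm \<Rightarrow> 'f trm" where
  "lam p M = Lam (map_pat snd p) (close 0 (pvars p) M)"

inductive lc :: "'f trm \<Rightarrow> bool" where
  "lc (FVar x)"
| "lc M \<Longrightarrow> lc (Bang M)"
| "pattern p \<Longrightarrow> lc M \<Longrightarrow> lc (lam p M)"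
| "lc M \<Longrightarrow> lc N \<Longrightarrow> lc (App M N)"
| "lc Unit"
| "lc M \<Longrightarrow> lc N \<Longrightarrow> lc (Pair M N)"
| "lc WUnit"
| "lc M \<Longrightarrow> lc N \<Longrightarrow> lc (WPair M N)"
| "lc (Num r)"
| "lc (Fn f)"
| "lc Plus"
| "lc Times"

fun FV :: "'f trm \<Rightarrow> var set" where
  "FV (FVar x) = {x}"
| "FV (BVar i j) = {}"
| "FV (Bang M) = FV M"
| "FV (Lam P M) = FV M"
| "FV (App M N) = FV M \<union> FV N"
| "FV Unit = {}"
| "FV (Pair M N) = FV M \<union> FV N"
| "FV WUnit = {}"
| "FV (WPair M N) = FV M \<union> FV N"
| "FV (Num r) = {}"
| "FV (Fn f) = {}"
| "FV Plus = {}"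
| "FV Times = {}"

text \<open>\<open>subst x N M\<close> is \<open>M{N/x}\<close>. It is capture-avoiding as soon as \<open>lc N\<close>.\<close>

fun subst :: "var \<Rightarrow> 'f trm \<Rightarrow> 'f trm \<Rightarrow> 'f trm" where
  "subst x N (FVar y) = (if y = x then N else FVar y)"
| "subst x N (BVar i j) = BVar i j"
| "subst x N (Bang M) = Bang (subst x N M)"
| "subst x N (Lam P M) = Lam P (subst x N M)"
| "subst x N (App M M') = App (subst x N M) (subst x N M')"
| "subst x N Unit = Unit"
| "subst x N (Pair M M') = Pair (subst x N M) (subst x N M')"
| "subst x N WUnit = WUnit"
| "subst x N (WPair M M') = WPair (subst x N M) (subst x N M')"
| "subst x N (Num r) = Num r"
| "subst x N (Fn f) = Fn f"
| "subst x N Plus = Plus"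
| "subst x N Times = Times"

lemma FV_close: "FV (close k xs M) = FV M - set xs"
  by (induction M arbitrary: k) auto

lemma FV_lam: "FV (lam p M) = FV M - set (pvars p)"
  by (simp add: lam_def FV_close)

lemma close_fresh: "FV M \<inter> set xs = {} \<Longrightarrow> close k xs M = M"
  by (induction M arbitrary: k) auto

lemma subst_close:
  "x \<notin> set xs \<Longrightarrow> FV N \<inter> set xs = {} \<Longrightarrow> subst x N (close k xs M) = close k xs (subst x N M)"
  by (induction M arbitrary: k) (auto simp: close_fresh)

lemma subst_lam:
  "x \<notin> set (pvars p) \<Longrightarrow> FV N \<inter> set (pvars p) = {} \<Longrightarrow> subst x N (lam p M) = lam p (subst x N M)"
  by (simp add: lam_def subst_close)

inductive subterm :: "'f trm \<Rightarrow> 'f trm \<Rightarrow> bool" where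
  "subterm M M"
| "subterm N M \<Longrightarrow> subterm N (Bang M)"
| "subterm N M \<Longrightarrow> pattern p \<Longrightarrow> lc M \<Longrightarrow> subterm N (lam p M)"
| "subterm N M \<Longrightarrow> subterm N (App M M')"
| "subterm N M' \<Longrightarrow> subterm N (App M M')"
| "subterm N M \<Longrightarrow> subterm N (Pair M M')"
| "subterm N M' \<Longrightarrow> subterm N (Pair M M')"
| "subterm N M \<Longrightarrow> subterm N (WPair M M')"
| "subterm N M' \<Longrightarrow> subterm N (WPair M M')"

text \<open>Only the values of \<open>interp \<Sigma> f\<close> on lists of length \<open>arity \<Sigma> f\<close> are relevant.\<close>

record 'f signature =
  arity :: "'f \<Rightarrow> nat"
  interp :: "'f \<Rightarrow> real list \<Rightarrow> real"

text \<open>Frechet differentiability on the whole of \<open>\<real>\<^sup>n\<close>, with \<open>\<real>\<^sup>n\<close> rendered as the lists of length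
  \<open>n\<close> because \<open>n\<close> depends on the function symbol; \<open>a\<close> is the gradient at \<open>x\<close>.\<close>

definition differentiable_Rn :: "nat \<Rightarrow> (real list \<Rightarrow> real) \<Rightarrow> bool" where
  "differentiable_Rn n f \<longleftrightarrow>
     (\<forall>x. length x = n \<longrightarrow>
       (\<exists>a. length a = n \<and>
         (\<forall>e>0. \<exists>d>0. \<forall>h. length h = n \<and> L2_set ((!) h) {..<n} < d \<longrightarrow>
            \<bar>f (map2 (+) x h) - f x - (\<Sum>i<n. a ! i * h ! i)\<bar> \<le> e * L2_set ((!) h) {..<n})))"

definition wf_signature :: "'f signature \<Rightarrow> bool" where
  "wf_signature \<Sigma> \<longleftrightarrow> (\<forall>f. arity \<Sigma> f \<ge> 1 \<and> differentiable_Rn (arity \<Sigma> f) (interp \<Sigma> f))"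

text \<open>Iterated tensors and tuples associate to the right; the empty case is never used.\<close>

fun tensors :: "ty list \<Rightarrow> ty" where
  "tensors [] = TOne"
| "tensors [A] = A"
| "tensors (A # B # As) = TTensor A (tensors (B # As))"

fun tuple :: "'f trm list \<Rightarrow> 'f trm" where
  "tuple [] = Unit"
| "tuple [M] = M"
| "tuple (M # N # Ms) = Pair M (tuple (N # Ms))"

definition evars :: "var pat set \<Rightarrow> var set" where
  "evars \<Delta> = (\<Union>p\<in>\<Delta>. set (pvars p))"

definition env :: "var pat set \<Rightarrow> bool" where
  "env \<Delta> \<longleftrightarrow> finite \<Delta> \<and> (\<forall>p\<in>\<Delta>. pattern p) \<and>
     (\<forall>p\<in>\<Delta>. \<forall>q\<in>\<Delta>. p \<noteq> q \<longrightarrow> set (pvars p) \<inter> set (pvars q) = {})"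

definition exponential :: "var pat set \<Rightarrow> bool" where
  "exponential \<Delta> \<longleftrightarrow> (\<forall>p\<in>\<Delta>. \<exists>x. p = PBang x)"

text \<open>The comma of environments is a union subject to \<open>apart\<close>.\<close>

definition apart :: "var pat set \<Rightarrow> var pat set \<Rightarrow> bool" where
  "apart \<Gamma> \<Delta> \<longleftrightarrow> evars \<Gamma> \<inter> evars \<Delta> = {}"

inductive typing :: "'f signature \<Rightarrow> var pat set \<Rightarrow> 'f trm \<Rightarrow> ty \<Rightarrow> bool" for \<Sigma> where
  T_Var: "typing \<Sigma> {PVar x} (FVar x) (snd x)"
| T_EVar: "typing \<Sigma> {PBang x} (FVar x) (snd x)"
| T_Bang: "typing \<Sigma> \<Gamma> M A \<Longrightarrow> exponential \<Gamma> \<Longrightarrow> typing \<Sigma> \<Gamma> (Bang M) (TBang A)"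
| T_Weak: "typing \<Sigma> \<Delta> M B \<Longrightarrow> apart {PBang x} \<Delta> \<Longrightarrow> typing \<Sigma> (insert (PBang x) \<Delta>) M B"
| T_Lam: "typing \<Sigma> (insert p \<Delta>) M B \<Longrightarrow> apart {p} \<Delta> \<Longrightarrow>
    typing \<Sigma> \<Delta> (lam p M) (TLolli (ptype p) B)"
| T_App: "typing \<Sigma> (\<Gamma>\<^sub>1 \<union> \<Delta>\<^sub>1) M (TLolli A B) \<Longrightarrow> typing \<Sigma> (\<Gamma>\<^sub>2 \<union> \<Delta>\<^sub>2) N A \<Longrightarrow>
    exponential \<Gamma>\<^sub>1 \<Longrightarrow> exponential \<Gamma>\<^sub>2 \<Longrightarrow>
    apart (\<Gamma>\<^sub>1 \<union> \<Gamma>\<^sub>2) \<Delta>\<^sub>1 \<Longrightarrow> apart (\<Gamma>\<^sub>1 \<union> \<Gamma>\<^sub>2) \<Delta>\<^sub>2 \<Longrightarrow> apart \<Delta>\<^sub>1 \<Delta>\<^sub>2 \<Longrightarrow>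
    typing \<Sigma> (\<Gamma>\<^sub>1 \<union> \<Gamma>\<^sub>2 \<union> \<Delta>\<^sub>1 \<union> \<Delta>\<^sub>2) (App M N) B"
| T_Unit: "typing \<Sigma> {} Unit TOne"
| T_UnitL: "typing \<Sigma> \<Delta> M B \<Longrightarrow> typing \<Sigma> (insert PUnit \<Delta>) M B"
| T_Pair: "typing \<Sigma> (\<Gamma>\<^sub>1 \<union> \<Delta>\<^sub>1) M A \<Longrightarrow> typing \<Sigma> (\<Gamma>\<^sub>2 \<union> \<Delta>\<^sub>2) N B \<Longrightarrow>
    exponential \<Gamma>\<^sub>1 \<Longrightarrow> exponential \<Gamma>\<^sub>2 \<Longrightarrow>
    apart (\<Gamma>\<^sub>1 \<union> \<Gamma>\<^sub>2) \<Delta>\<^sub>1 \<Longrightarrow> apart (\<Gamma>\<^sub>1 \<union> \<Gamma>\<^sub>2) \<Delta>\<^sub>2 \<Longrightarrow> apart \<Delta>\<^sub>1 \<Delta>\<^sub>2 \<Longrightarrow>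
    typing \<Sigma> (\<Gamma>\<^sub>1 \<union> \<Gamma>\<^sub>2 \<union> \<Delta>\<^sub>1 \<union> \<Delta>\<^sub>2) (Pair M N) (TTensor A B)"
| T_PairL: "typing \<Sigma> (insert p (insert q \<Delta>)) M C \<Longrightarrow>
    apart {p} {q} \<Longrightarrow> apart {p} \<Delta> \<Longrightarrow> apart {q} \<Delta> \<Longrightarrow>
    typing \<Sigma> (insert (PPair p q) \<Delta>) M C"
| T_WPair: "typing \<Sigma> \<Delta> M A \<Longrightarrow> typing \<Sigma> \<Delta> N B \<Longrightarrow> typing \<Sigma> \<Delta> (WPair M N) (TWith A B)"
| T_WithL1: "typing \<Sigma> (insert p \<Delta>) M B \<Longrightarrow> apart {p} \<Delta> \<Longrightarrow>
    pattern (PWith p q) \<Longrightarrow> apart {PWith p q} \<Delta> \<Longrightarrow>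
    typing \<Sigma> (insert (PWith p q) \<Delta>) M B"
| T_WithL2: "typing \<Sigma> (insert q \<Delta>) M B \<Longrightarrow> apart {q} \<Delta> \<Longrightarrow>
    pattern (PWith p q) \<Longrightarrow> apart {PWith p q} \<Delta> \<Longrightarrow>
    typing \<Sigma> (insert (PWith p q) \<Delta>) M B"
| T_WUnit: "env \<Delta> \<Longrightarrow> typing \<Sigma> \<Delta> WUnit TTop"
| T_Num: "typing \<Sigma> {} (Num r) TReal"
| T_Zero: "env \<Delta> \<Longrightarrow> typing \<Sigma> \<Delta> (Num 0) TReal"
| T_Fn: "typing \<Sigma> {} (Fn f) (TLolli (tensors (replicate (arity \<Sigma> f) (TBang TReal))) (TBang TReal))"
| T_Plus: "typing \<Sigma> {} Plus (TLolli (TWith TReal TReal) TReal)"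
| T_Times: "typing \<Sigma> {} Times (TLolli TReal (TLolli TReal TReal))"

lemma env_insertD: "env (insert p \<Delta>) \<Longrightarrow> pattern p \<and> env \<Delta>"
  by (auto simp: env_def)

lemma env_insertI: "pattern p \<Longrightarrow> env \<Delta> \<Longrightarrow> apart {p} \<Delta> \<Longrightarrow> env (insert p \<Delta>)"
  by (auto simp: env_def apart_def evars_def)

lemma env_UnD: "env (\<Gamma> \<union> \<Delta>) \<Longrightarrow> env \<Gamma> \<and> env \<Delta>"
  by (auto simp: env_def)

lemma env_UnI: "env \<Gamma> \<Longrightarrow> env \<Delta> \<Longrightarrow> apart \<Gamma> \<Delta> \<Longrightarrow> env (\<Gamma> \<union> \<Delta>)"
  unfolding env_def apart_def evars_def by (simp add: ball_Un) blast

lemma env_Un_exponential: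
  "env \<Gamma> \<Longrightarrow> env \<Delta> \<Longrightarrow> exponential \<Gamma> \<Longrightarrow> exponential \<Delta> \<Longrightarrow> env (\<Gamma> \<union> \<Delta>)"
  unfolding env_def exponential_def by (simp add: ball_Un) fastforce

lemma env_comma:
  assumes "env (\<Gamma>\<^sub>1 \<union> \<Delta>\<^sub>1)" "env (\<Gamma>\<^sub>2 \<union> \<Delta>\<^sub>2)" "exponential \<Gamma>\<^sub>1" "exponential \<Gamma>\<^sub>2"
    "apart (\<Gamma>\<^sub>1 \<union> \<Gamma>\<^sub>2) \<Delta>\<^sub>1" "apart (\<Gamma>\<^sub>1 \<union> \<Gamma>\<^sub>2) \<Delta>\<^sub>2" "apart \<Delta>\<^sub>1 \<Delta>\<^sub>2"
  shows "env (\<Gamma>\<^sub>1 \<union> \<Gamma>\<^sub>2 \<union> \<Delta>\<^sub>1 \<union> \<Delta>\<^sub>2)"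
proof -
  have "env (\<Gamma>\<^sub>1 \<union> \<Gamma>\<^sub>2)" using assms by (metis env_UnD env_Un_exponential)
  then have "env (\<Gamma>\<^sub>1 \<union> \<Gamma>\<^sub>2 \<union> \<Delta>\<^sub>1)" using assms by (metis env_UnD env_UnI)
  moreover have "apart (\<Gamma>\<^sub>1 \<union> \<Gamma>\<^sub>2 \<union> \<Delta>\<^sub>1) \<Delta>\<^sub>2"
    using assms by (auto simp: apart_def evars_def)
  ultimately show ?thesis using assms by (metis env_UnD env_UnI)
qed

lemma apart_PPair: "apart {p} \<Delta> \<Longrightarrow> apart {q} \<Delta> \<Longrightarrow> apart {PPair p q} \<Delta>"
  by (auto simp: apart_def evars_def)

lemma pattern_PPair: "pattern p \<Longrightarrow> pattern q \<Longrightarrow> apart {p} {q} \<Longrightarrow> pattern (PPair p q)"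
  by (auto simp: pattern_def apart_def evars_def)

lemma typing_lc_env: "typing \<Sigma> \<Delta> M A \<Longrightarrow> lc M \<and> env \<Delta>"
proof (induction rule: typing.induct)
  case (T_Weak \<Delta> M B x)
  then show ?case by (auto intro: env_insertI simp: pattern_def)
next
  case (T_UnitL \<Delta> M B)
  then show ?case by (auto intro!: env_insertI simp: pattern_def apart_def evars_def)
next
  case (T_PairL p q \<Delta> M C)
  then show ?case by (metis env_insertD env_insertI apart_PPair pattern_PPair)
next
  case (T_App \<Gamma>\<^sub>1 \<Delta>\<^sub>1 M A B \<Gamma>\<^sub>2 \<Delta>\<^sub>2 N)
  then show ?case by (metis env_comma lc.intros(4))
next
  case (T_Pair \<Gamma>\<^sub>1 \<Delta>\<^sub>1 M A \<Gamma>\<^sub>2 \<Delta>\<^sub>2 N B)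
  then show ?case by (metis env_comma lc.intros(6))
next
  case (T_Lam p \<Delta> M B)
  then show ?case by (metis env_insertD lc.intros(3))
next
  case (T_WithL1 p \<Delta> M B q)
  then show ?case by (metis env_insertD env_insertI)
next
  case (T_WithL2 q \<Delta> M B p)
  then show ?case by (metis env_insertD env_insertI)
qed (auto intro: lc.intros simp: env_def pattern_def)

text \<open>No typing premise is needed in the variable case: in a well-typed application
  \<open>App (lam p M) V\<close> the argument \<open>V\<close> has the type of \<open>p\<close>.\<close>

fun val :: "var pat \<Rightarrow> 'f trm \<Rightarrow> bool" where
  "val (PVar x) V = True"
| "val PUnit Unit = True"
| "val (PBang x) (Bang M) = True"
| "val (PPair p q) (Pair V W) = (val p V \<and> val q W)"
| "val (PWith p q) (WPair V W) = (val p V \<and> val q W)"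
| "val _ _ = False"

text \<open>\<open>psubst p V M\<close> is \<open>M{V/p}\<close>, specified only when \<open>V\<close> is a value for \<open>p\<close>.\<close>

fun psubst :: "var pat \<Rightarrow> 'f trm \<Rightarrow> 'f trm \<Rightarrow> 'f trm" where
  "psubst (PVar x) V M = subst x V M"
| "psubst PUnit Unit M = M"
| "psubst (PBang x) (Bang N) M = subst x N M"
| "psubst (PPair p q) (Pair V W) M = psubst q W (psubst p V M)"
| "psubst (PWith p q) (WPair V W) M = psubst q W (psubst p V M)"

fun strong_value :: "'f trm \<Rightarrow> bool" where
  "strong_value (FVar x) = True"
| "strong_value (Num r) = True"
| "strong_value (Fn f) = True"
| "strong_value Plus = True"
| "strong_value Times = True"
| "strong_value (Lam P M) = True"
| "strong_value Unit = True"
| "strong_value (Pair V W) = (strong_value V \<and> strong_value W)"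
| "strong_value WUnit = True"
| "strong_value (WPair V W) = (strong_value V \<and> strong_value W)"
| "strong_value (Bang V) = strong_value V"
| "strong_value (App Times V) = strong_value V"
| "strong_value _ = False"

text \<open>By \<open>\<alpha>\<close>-conversion \<open>p\<close> can always be chosen fresh for \<open>V\<close>, which makes the iterated
  substitution in \<open>psubst\<close> correct.\<close>

inductive beta_rule :: "'f trm \<Rightarrow> 'f trm \<Rightarrow> bool" where
  "pattern p \<Longrightarrow> lc M \<Longrightarrow> lc V \<Longrightarrow> val p V \<Longrightarrow> set (pvars p) \<inter> FV V = {} \<Longrightarrow>
     beta_rule (App (lam p M) V) (psubst p V M)"

inductive safe_beta_rule :: "'f trm \<Rightarrow> 'f trm \<Rightarrow> bool" where
  "pattern p \<Longrightarrow> lc M \<Longrightarrow> lc W \<Longrightarrow> val p W \<Longrightarrow> strong_value W \<Longrightarrow> FV W = {} \<Longrightarrow>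
     safe_beta_rule (App (lam p M) W) (psubst p W M)"

inductive numeric_rule :: "'f signature \<Rightarrow> 'f trm \<Rightarrow> 'f trm \<Rightarrow> bool" for \<Sigma> where
  "length rs = arity \<Sigma> f \<Longrightarrow>
     numeric_rule \<Sigma> (App (Fn f) (tuple (map (\<lambda>r. Bang (Num r)) rs))) (Bang (Num (interp \<Sigma> f rs)))"
| "numeric_rule \<Sigma> (App Plus (WPair (Num r) (Num s))) (Num (r + s))"
| "numeric_rule \<Sigma> (App (App Times (Num r)) (Num s)) (Num (r * s))"

inductive ctx_closure :: "('f trm \<Rightarrow> 'f trm \<Rightarrow> bool) \<Rightarrow> 'f trm \<Rightarrow> 'f trm \<Rightarrow> bool" for R where
  "R M M' \<Longrightarrow> ctx_closure R M M'"
| "ctx_closure R M M' \<Longrightarrow> ctx_closure R (Bang M) (Bang M')"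
| "ctx_closure R M M' \<Longrightarrow> pattern p \<Longrightarrow> lc M \<Longrightarrow> ctx_closure R (lam p M) (lam p M')"
| "ctx_closure R M M' \<Longrightarrow> ctx_closure R (App M N) (App M' N)"
| "ctx_closure R N N' \<Longrightarrow> ctx_closure R (App M N) (App M N')"
| "ctx_closure R M M' \<Longrightarrow> ctx_closure R (Pair M N) (Pair M' N)"
| "ctx_closure R N N' \<Longrightarrow> ctx_closure R (Pair M N) (Pair M N')"
| "ctx_closure R M M' \<Longrightarrow> ctx_closure R (WPair M N) (WPair M' N)"
| "ctx_closure R N N' \<Longrightarrow> ctx_closure R (WPair M N) (WPair M N')"

definition beta :: "'f signature \<Rightarrow> 'f trm \<Rightarrow> 'f trm \<Rightarrow> bool" where
  "beta \<Sigma> = ctx_closure (\<lambda>M N. beta_rule M N \<or> numeric_rule \<Sigma> M N)"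

definition beta_normal :: "'f signature \<Rightarrow> 'f trm \<Rightarrow> bool" where
  "beta_normal \<Sigma> M \<longleftrightarrow> (\<nexists>N. beta \<Sigma> M N)"

text \<open>Safe steps are labelled by the rule they use, so that numeric steps can be counted.\<close>

datatype kind = Beta | Numeric

fun safe_step :: "'f signature \<Rightarrow> kind \<Rightarrow> 'f trm \<Rightarrow> 'f trm \<Rightarrow> bool" where
  "safe_step \<Sigma> Beta = ctx_closure safe_beta_rule"
| "safe_step \<Sigma> Numeric = ctx_closure (numeric_rule \<Sigma>)"

text \<open>A sequence of \<open>n\<close> safe steps, with \<open>n = \<infinity>\<close> allowed: the \<open>i\<close>-th step goes from \<open>s i\<close> to
  \<open>s (Suc i)\<close> and has kind \<open>k i\<close>. Entries of \<open>s\<close> and \<open>k\<close> beyond the length are irrelevant.\<close>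

definition safe_seq :: "'f signature \<Rightarrow> enat \<Rightarrow> (nat \<Rightarrow> 'f trm) \<Rightarrow> (nat \<Rightarrow> kind) \<Rightarrow> bool" where
  "safe_seq \<Sigma> n s k \<longleftrightarrow> (\<forall>i. enat i < n \<longrightarrow> safe_step \<Sigma> (k i) (s i) (s (Suc i)))"

definition maximal_safe_seq :: "'f signature \<Rightarrow> enat \<Rightarrow> (nat \<Rightarrow> 'f trm) \<Rightarrow> (nat \<Rightarrow> kind) \<Rightarrow> bool" where
  "maximal_safe_seq \<Sigma> n s k \<longleftrightarrow> safe_seq \<Sigma> n s k \<and>
     (\<forall>m. n = enat m \<longrightarrow> (\<nexists>j N. safe_step \<Sigma> j (s m) N))"

definition numeric_steps :: "enat \<Rightarrow> (nat \<Rightarrow> kind) \<Rightarrow> nat set" where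
  "numeric_steps n k = {i. enat i < n \<and> k i = Numeric}"

fun ty_workload :: "ty \<Rightarrow> nat" where
  "ty_workload TReal = 1"
| "ty_workload (TLolli A B) = ty_workload A + ty_workload B"
| "ty_workload TOne = 0"
| "ty_workload (TTensor A B) = ty_workload A + ty_workload B"
| "ty_workload TTop = 0"
| "ty_workload (TWith A B) = ty_workload A + ty_workload B"
| "ty_workload (TBang A) = 0"

text \<open>Positions of the variables of the \<open>k\<close>-th enclosing pattern that occur in a term.\<close>

fun bound_at :: "nat \<Rightarrow> 'f trm \<Rightarrow> nat set" where
  "bound_at k (FVar x) = {}"
| "bound_at k (BVar i j) = (if i = k then {j} else {})"
| "bound_at k (Bang M) = bound_at k M"
| "bound_at k (Lam P M) = bound_at (Suc k) M"
| "bound_at k (App M N) = bound_at k M \<union> bound_at k N"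
| "bound_at k Unit = {}"
| "bound_at k (Pair M N) = bound_at k M \<union> bound_at k N"
| "bound_at k WUnit = {}"
| "bound_at k (WPair M N) = bound_at k M \<union> bound_at k N"
| "bound_at k (Num r) = {}"
| "bound_at k (Fn f) = {}"
| "bound_at k Plus = {}"
| "bound_at k Times = {}"

text \<open>The clause for \<open>Lam\<close> is rephrased with named patterns in lemma \<open>workload_lam\<close> below.\<close>

fun workload :: "'f trm \<Rightarrow> nat" where
  "workload (FVar x) = 0"
| "workload (BVar i j) = 0"
| "workload (Bang M) = 0"
| "workload (Lam P M) =
     workload M + (\<Sum>j\<in>{..<length (pvars P)} - bound_at 0 M. ty_workload (pvars P ! j))"
| "workload (App M N) = workload M + workload N"
| "workload Unit = 0"
| "workload (Pair M N) = workload M + workload N"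
| "workload WUnit = 0"
| "workload (WPair M N) = workload M + workload N"
| "workload (Num r) = 0"
| "workload (Fn f) = 1"
| "workload Plus = 1"
| "workload Times = 1"

lemma bound_at_close:
  "bound_at k (close k' xs M) =
     bound_at k M \<union> (if k = k' then (\<lambda>x. pos x xs) ` (FV M \<inter> set xs) else {})"
  by (induction M arbitrary: k k') auto

lemma workload_close: "workload (close k xs M) = workload M"
  by (induction M arbitrary: k) (auto simp: bound_at_close)

lemma bound_at_lc: "lc M \<Longrightarrow> bound_at k M = {}"
  by (induction M arbitrary: k rule: lc.induct) (auto simp: lam_def bound_at_close)

lemma pvars_map: "pvars (map_pat f p) = map f (pvars p)"
  by (induction p) auto

lemma pos_less: "x \<in> set xs \<Longrightarrow> pos x xs < length xs"
  by (induction xs) auto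

lemma nth_pos: "x \<in> set xs \<Longrightarrow> xs ! pos x xs = x"
  by (induction xs) auto

lemma pos_nth: "distinct xs \<Longrightarrow> j < length xs \<Longrightarrow> pos (xs ! j) xs = j"
  using nth_eq_iff_index_eq nth_pos pos_less nth_mem by metis

lemma workload_lam:
  assumes "pattern p" "lc M"
  shows "workload (lam p M) = workload M + (\<Sum>x\<in>set (pvars p) - FV M. ty_workload (snd x))"
proof -
  let ?xs = "pvars p"
  let ?J = "{..<length ?xs} - (\<lambda>x. pos x ?xs) ` (FV M \<inter> set ?xs)"
  have d: "distinct ?xs" using assms(1) by (simp add: pattern_def)
  have inj: "inj_on (\<lambda>x. pos x ?xs) (set ?xs)" by (rule inj_on_inverseI[where g = "(!) ?xs"]) (rule nth_pos)
  have "(\<lambda>x. pos x ?xs) ` set ?xs = {..<length ?xs}"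
  proof
    show "{..<length ?xs} \<subseteq> (\<lambda>x. pos x ?xs) ` set ?xs"
    proof
      fix j assume "j \<in> {..<length ?xs}"
      then show "j \<in> (\<lambda>x. pos x ?xs) ` set ?xs"
        using pos_nth[OF d, of j] by (intro image_eqI[of _ _ "?xs ! j"]) auto
    qed
  qed (auto simp: pos_less)
  then have J: "?J = (\<lambda>x. pos x ?xs) ` (set ?xs - FV M)"
    using inj_on_image_set_diff[OF inj, of "set ?xs" "FV M \<inter> set ?xs"] by (simp add: Diff_Int)
  have "(\<Sum>j\<in>?J. ty_workload (snd (?xs ! j))) = (\<Sum>x\<in>set ?xs - FV M. ty_workload (snd x))"
    unfolding J by (subst sum.reindex) (auto intro: inj_on_subset[OF inj] simp: nth_pos)
  moreover have "(\<Sum>j\<in>?J. ty_workload (map snd ?xs ! j)) = (\<Sum>j\<in>?J. ty_workload (snd (?xs ! j)))"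
    by (rule sum.cong) auto
  ultimately show ?thesis
    using assms(2) by (simp add: lam_def workload_close pvars_map bound_at_close bound_at_lc)
qed

definition safe_term :: "'f trm \<Rightarrow> bool" where
  "safe_term M \<longleftrightarrow>
     (\<forall>M'. subterm (Bang M') M \<longrightarrow> workload M' = 0) \<and>
     (\<forall>M\<^sub>1 M\<^sub>2. subterm (WPair M\<^sub>1 M\<^sub>2) M \<longrightarrow> (\<forall>x\<in>FV M\<^sub>1 \<inter> FV M\<^sub>2. ground (snd x)))"

end

theory Submission imports Defs begin

text \<open>
  A safe redex only substitutes a closed value, so a step never changes which outer variables occur
  in the contracted redex or in any term around it. Hence affinity and the safety conditions are
  stable under reduction. The workload cannot grow: a value that gets duplicated
  either comes from under a \<open>!\<close> or is a closed strong value of ground type, and both have workload 0.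
  A numeric step consumes one function symbol, so it decreases the workload by at least 1;
  in particular it cannot happen under a \<open>!\<close>. Termination follows from Girard's reducibility method
  for a typing in which patterns are flattened and weakening is free. Finally, closed typed terms that
  are not strong values can be reduced.
\<close>

section \<open>Reduction without names\<close>

text \<open>Naming binders is awkward when redexes fire under them, so invariance and termination
  are proved for \<open>rstep\<close>, a relation on raw terms that opens bodies by index and
  contains every safe step. Progress asserts that a step exists, so it is proved for
  \<open>safe_step\<close> itself, where binders have to be named again. The workload bound is
  obtained from sets of occurring positions: each component of a substituted value is counted once,
  however often its variable occurs. This count is sound only if whatever occurs in two subterms
  costs nothing, which is why the side conditions on sharing travel with the types in one
  judgement.\<close>

fun lcat :: "nat \<Rightarrow> 'f trm \<Rightarrow> bool" where
  "lcat k (FVar x) = True"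
| "lcat k (BVar i j) = (i < k)"
| "lcat k (Bang M) = lcat k M"
| "lcat k (Lam P M) = lcat (Suc k) M"
| "lcat k (App M N) = (lcat k M \<and> lcat k N)"
| "lcat k Unit = True"
| "lcat k (Pair M N) = (lcat k M \<and> lcat k N)"
| "lcat k WUnit = True"
| "lcat k (WPair M N) = (lcat k M \<and> lcat k N)"
| "lcat k (Num r) = True"
| "lcat k (Fn f) = True"
| "lcat k Plus = True"
| "lcat k Times = True"

text \<open>\<open>Unit\<close> is closed and has workload 0, so with this default most statements
  about opening hold whether or not \<open>j\<close> is in range.\<close>

definition nth_or_unit :: "'f trm list \<Rightarrow> nat \<Rightarrow> 'f trm" where
  "nth_or_unit Vs j = (if j < length Vs then Vs ! j else Unit)"

text \<open>The indices above \<open>k\<close> are decremented because the \<open>k\<close>-th binder disappears. No lifting of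
  \<open>Vs\<close> is needed: only locally closed terms are ever substituted.\<close>

fun opn :: "nat \<Rightarrow> 'f trm list \<Rightarrow> 'f trm \<Rightarrow> 'f trm" where
  "opn k Vs (FVar x) = FVar x"
| "opn k Vs (BVar i j) =
     (if i < k then BVar i j else if i = k then nth_or_unit Vs j else BVar (i - 1) j)"
| "opn k Vs (Bang M) = Bang (opn k Vs M)"
| "opn k Vs (Lam P M) = Lam P (opn (Suc k) Vs M)"
| "opn k Vs (App M N) = App (opn k Vs M) (opn k Vs N)"
| "opn k Vs Unit = Unit"
| "opn k Vs (Pair M N) = Pair (opn k Vs M) (opn k Vs N)"
| "opn k Vs WUnit = WUnit"
| "opn k Vs (WPair M N) = WPair (opn k Vs M) (opn k Vs N)"
| "opn k Vs (Num r) = Num r"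
| "opn k Vs (Fn f) = Fn f"
| "opn k Vs Plus = Plus"
| "opn k Vs Times = Times"

text \<open>\<open>val\<close> is confined to \<open>var pat\<close>, whereas the binder of a
  \<open>Lam\<close> stores a \<open>ty pat\<close>; matching depends on the shape of the pattern
  alone.\<close>

fun matches :: "'v pat \<Rightarrow> 'f trm \<Rightarrow> bool" where
  "matches (PVar x) V = True"
| "matches PUnit Unit = True"
| "matches (PBang x) (Bang M) = True"
| "matches (PPair p q) (Pair V W) = (matches p V \<and> matches q W)"
| "matches (PWith p q) (WPair V W) = (matches p V \<and> matches q W)"
| "matches _ _ = False"

text \<open>The order is that of \<open>pvars\<close>, so entry \<open>j\<close> is what replaces
  \<open>BVar 0 j\<close> in the body of a redex.\<close>

fun components :: "'v pat \<Rightarrow> 'f trm \<Rightarrow> 'f trm list" where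
  "components (PVar x) V = [V]"
| "components (PBang x) (Bang M) = [M]"
| "components (PPair p q) (Pair V W) = components p V @ components q W"
| "components (PWith p q) (WPair V W) = components p V @ components q W"
| "components _ _ = []"

definition closed_term :: "'f trm \<Rightarrow> bool" where
  "closed_term M \<longleftrightarrow> lcat 0 M \<and> FV M = {}"

text \<open>One labelled relation on raw terms. Contracting by index requires no choice of names,
  also under \<open>Lam\<close>.\<close>

inductive rstep :: "'f signature \<Rightarrow> kind \<Rightarrow> 'f trm \<Rightarrow> 'f trm \<Rightarrow> bool" for \<Sigma> where
  rs_beta: "closed_term W \<Longrightarrow> strong_value W \<Longrightarrow> matches P W \<Longrightarrow>
     rstep \<Sigma> Beta (App (Lam P M) W) (opn 0 (components P W) M)"
| rs_num: "numeric_rule \<Sigma> M N \<Longrightarrow> rstep \<Sigma> Numeric M N"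
| rs_Bang: "rstep \<Sigma> k M M' \<Longrightarrow> rstep \<Sigma> k (Bang M) (Bang M')"
| rs_Lam: "rstep \<Sigma> k M M' \<Longrightarrow> rstep \<Sigma> k (Lam P M) (Lam P M')"
| rs_App1: "rstep \<Sigma> k M M' \<Longrightarrow> rstep \<Sigma> k (App M N) (App M' N)"
| rs_App2: "rstep \<Sigma> k N N' \<Longrightarrow> rstep \<Sigma> k (App M N) (App M N')"
| rs_Pair1: "rstep \<Sigma> k M M' \<Longrightarrow> rstep \<Sigma> k (Pair M N) (Pair M' N)"
| rs_Pair2: "rstep \<Sigma> k N N' \<Longrightarrow> rstep \<Sigma> k (Pair M N) (Pair M N')"
| rs_WPair1: "rstep \<Sigma> k M M' \<Longrightarrow> rstep \<Sigma> k (WPair M N) (WPair M' N)"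
| rs_WPair2: "rstep \<Sigma> k N N' \<Longrightarrow> rstep \<Sigma> k (WPair M N) (WPair M N')"

section \<open>Opening and closing of indices\<close>

lemma lcat_mono: "lcat k M \<Longrightarrow> k \<le> k' \<Longrightarrow> lcat k' M"
  by (induction M arbitrary: k k') auto

lemma lcat_0: "lcat 0 M \<Longrightarrow> lcat k M"
  using lcat_mono by blast

lemma bound_at_lcat: "lcat k M \<Longrightarrow> k \<le> i \<Longrightarrow> bound_at i M = {}"
  by (induction M arbitrary: k i) auto

lemma bound_at_lcat_0: "lcat 0 M \<Longrightarrow> bound_at i M = {}"
  by (simp add: bound_at_lcat)

lemma lcat_close: "lcat k M \<Longrightarrow> lcat (Suc k) (close k xs M)"
  by (induction M arbitrary: k) auto

lemma lc_lcat: "lc M \<Longrightarrow> lcat 0 M"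
  by (induction rule: lc.induct) (auto simp: lam_def lcat_close)

lemma opn_lcat: "lcat k M \<Longrightarrow> opn k Vs M = M"
  by (induction M arbitrary: k) auto

lemma opn_lcat_0: "lcat 0 M \<Longrightarrow> opn k Vs M = M"
  by (simp add: lcat_0 opn_lcat)

lemma lcat_opn:
  "lcat (Suc k) M \<Longrightarrow> \<forall>V\<in>set Vs. lcat 0 V \<Longrightarrow> lcat k (opn k Vs M)"
  by (induction M arbitrary: k) (auto simp: nth_or_unit_def lcat_0)

lemma bound_at_opn:
  assumes "\<forall>V\<in>set Vs. lcat 0 V"
  shows "bound_at i (opn k Vs M) = (if i < k then bound_at i M else bound_at (Suc i) M)"
  using assms by (induction M arbitrary: i k) (auto simp: nth_or_unit_def bound_at_lcat_0)

lemma FV_opn: "\<forall>V\<in>set Vs. FV V = {} \<Longrightarrow> FV (opn k Vs M) = FV M"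
  by (induction M arbitrary: k) (auto simp: nth_or_unit_def)

text \<open>Locally closed terms contain no index that the other opening could hit. The outer index
  is \<open>Suc k\<close> as long as binder \<open>l\<close> is still counted.\<close>

lemma opn_opn:
  assumes "\<forall>V\<in>set Vs. lcat 0 V" "\<forall>W\<in>set Ws. lcat 0 W" "l \<le> k"
  shows "opn k Vs (opn l Ws M) = opn l Ws (opn (Suc k) Vs M)"
  using assms(3)
proof (induction M arbitrary: k l)
  case (BVar i j)
  have "opn k Vs (nth_or_unit Ws j) = nth_or_unit Ws j"
    using assms by (auto simp: nth_or_unit_def opn_lcat_0)
  moreover have "opn l Ws (nth_or_unit Vs j) = nth_or_unit Vs j"
    using assms by (auto simp: nth_or_unit_def opn_lcat_0)
  ultimately show ?case using BVar by auto
qed auto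

lemma close_opn:
  assumes "\<forall>V\<in>set Vs. FV V = {}" "l \<le> k"
  shows "close k xs (opn l Vs M) = opn l Vs (close (Suc k) xs M)"
  using assms(2)
proof (induction M arbitrary: k l)
  case (BVar i j)
  have "close k xs (nth_or_unit Vs j) = nth_or_unit Vs j"
    using assms by (auto simp: nth_or_unit_def intro!: close_fresh)
  then show ?case using BVar by auto
qed auto

lemma matches_map: "matches (map_pat f p) V = matches p V"
  by (induction p V rule: matches.induct) auto

lemma components_map: "components (map_pat f p) V = components p V"
  by (induction p V rule: components.induct) auto

lemma val_matches: "val p V = matches p V"
  by (induction p V rule: val.induct) auto

lemma length_components: "matches p V \<Longrightarrow> length (components p V) = length (pvars p)"
  by (induction p V rule: matches.induct) auto

lemma components_closed:
  "matches p V \<Longrightarrow> closed_term V \<Longrightarrow> U \<in> set (components p V) \<Longrightarrow> closed_term U"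
  by (induction p V rule: matches.induct) (auto simp: closed_term_def)

lemma components_strong_value:
  "matches p V \<Longrightarrow> strong_value V \<Longrightarrow> U \<in> set (components p V) \<Longrightarrow> strong_value U"
  by (induction p V rule: matches.induct) auto

lemma pos_append: "pos x (xs @ ys) = (if x \<in> set xs then pos x xs else length xs + pos x ys)"
  by (induction xs) auto

text \<open>Turns the two substitutions of a pair pattern into one simultaneous opening: closed
  terms put in for \<open>xs\<close> are left alone by the second stage. A name in both lists is
  claimed by \<open>xs\<close> on either side.\<close>

lemma opn_close_append:
  assumes "\<forall>V\<in>set Vs. closed_term V" "length xs = length Vs" "lcat k M"
  shows "opn k (Vs @ Ws) (close k (xs @ ys) M) = opn k Ws (close k ys (opn k Vs (close k xs M)))"
  using assms(3)
proof (induction M arbitrary: k)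
  case (FVar x)
  show ?case
  proof (cases "x \<in> set xs")
    case True
    then have "pos x xs < length Vs" using assms pos_less by metis
    moreover from this have "closed_term (Vs ! pos x xs)" using assms by simp
    ultimately show ?thesis using True
      by (auto simp: pos_append nth_or_unit_def nth_append closed_term_def close_fresh opn_lcat_0)
  qed (auto simp: pos_append nth_or_unit_def nth_append assms)
qed auto

lemma opn_close_single: "lcat k M \<Longrightarrow> opn k [V] (close k [x] M) = subst x V M"
  by (induction M arbitrary: k) (auto simp: nth_or_unit_def)

lemma opn_close_Nil: "lcat k M \<Longrightarrow> opn k [] (close k [] M) = M"
  by (simp add: close_fresh opn_lcat)

lemma psubst_opn:
  "val p W \<Longrightarrow> closed_term W \<Longrightarrow> lcat 0 M \<Longrightarrow>
     psubst p W M = opn 0 (components p W) (close 0 (pvars p) M)"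
proof (induction p W arbitrary: M rule: val.induct)
  case (4 p q V W)
  then have c: "\<forall>U\<in>set (components p V). closed_term U" "closed_term V" "closed_term W"
    using components_closed[of p V] by (auto simp: val_matches closed_term_def)
  then have "lcat 0 (opn 0 (components p V) (close 0 (pvars p) M))"
    using 4 by (intro lcat_opn lcat_close) (auto simp: closed_term_def)
  with 4 c show ?case
    by (auto simp: opn_close_append val_matches length_components)
next
  case (5 p q V W)
  then have c: "\<forall>U\<in>set (components p V). closed_term U" "closed_term V" "closed_term W"
    using components_closed[of p V] by (auto simp: val_matches closed_term_def)
  then have "lcat 0 (opn 0 (components p V) (close 0 (pvars p) M))"
    using 5 by (intro lcat_opn lcat_close) (auto simp: closed_term_def)
  with 5 c show ?case
    by (auto simp: opn_close_append val_matches length_components)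
qed (simp_all add: opn_close_single opn_close_Nil)

section \<open>Nameless steps under closing and opening\<close>

lemma FV_tuple_Bang_Num: "FV (tuple (map (\<lambda>r. Bang (Num r)) rs)) = {}"
  by (induction rs rule: induct_list012) auto

lemma lcat_tuple_Bang_Num: "lcat k (tuple (map (\<lambda>r. Bang (Num r)) rs))"
  by (induction rs rule: induct_list012) auto

lemma numeric_rule_closed: "numeric_rule \<Sigma> M N \<Longrightarrow> closed_term M \<and> closed_term N"
  by (induction rule: numeric_rule.induct)
     (auto simp: closed_term_def FV_tuple_Bang_Num lcat_tuple_Bang_Num)

text \<open>Lets a step pass under a named abstraction, since \<open>lam p\<close> closes both sides
  over \<open>pvars p\<close>. The argument of a redex is closed and therefore unaffected.\<close>

lemma rstep_close: "rstep \<Sigma> k M N \<Longrightarrow> rstep \<Sigma> k (close i xs M) (close i xs N)"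
proof (induction arbitrary: i rule: rstep.induct)
  case (rs_beta W P M)
  have "\<forall>V\<in>set (components P W). FV V = {}"
    using components_closed rs_beta unfolding closed_term_def by blast
  then show ?case using rs_beta
    by (auto simp: close_opn closed_term_def close_fresh intro!: rstep.rs_beta)
next
  case (rs_num M N)
  then show ?case using numeric_rule_closed[OF rs_num]
    by (auto simp: closed_term_def close_fresh intro: rstep.rs_num)
qed (auto intro: rstep.intros)

lemma ctx_closure_rstep:
  assumes "\<And>M N. R M N \<Longrightarrow> rstep \<Sigma> k M N" "ctx_closure R M N"
  shows "rstep \<Sigma> k M N"
  using assms(2) by induction (auto simp: lam_def intro: rstep.intros assms(1) rstep_close)

lemma safe_step_rstep: "safe_step \<Sigma> k M N \<Longrightarrow> rstep \<Sigma> k M N"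
proof (cases k)
  case Beta
  have "rstep \<Sigma> Beta M N" if "safe_beta_rule M N" for M N
    using that
  proof cases
    case (1 p M W)
    then have c: "closed_term W" by (simp add: closed_term_def lc_lcat)
    have "psubst p W M = opn 0 (components (map_pat snd p) W) (close 0 (pvars p) M)"
      using psubst_opn[of p W M] 1 c by (simp add: components_map lc_lcat)
    then show ?thesis using 1 c
      by (auto simp: lam_def matches_map val_matches intro!: rstep.rs_beta)
  qed
  moreover assume "safe_step \<Sigma> k M N"
  ultimately show ?thesis using Beta by (auto intro: ctx_closure_rstep)
qed (auto intro: ctx_closure_rstep rstep.rs_num)

lemma rstep_opn:
  assumes "rstep \<Sigma> k M N" "\<forall>V\<in>set Vs. lcat 0 V"
  shows "rstep \<Sigma> k (opn i Vs M) (opn i Vs N)"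
  using assms(1)
proof (induction arbitrary: i rule: rstep.induct)
  case (rs_beta W P M)
  have "\<forall>V\<in>set (components P W). lcat 0 V"
    using components_closed rs_beta unfolding closed_term_def by blast
  moreover have "opn i Vs W = W"
    using rs_beta by (auto simp: closed_term_def opn_lcat_0)
  ultimately show ?case using rs_beta assms(2) by (auto simp: opn_opn intro!: rstep.rs_beta)
next
  case (rs_num M N)
  have "opn i Vs M = M" "opn i Vs N = N"
    using numeric_rule_closed[OF rs_num] by (auto simp: closed_term_def opn_lcat_0)
  then show ?case using rs_num by (auto intro: rstep.rs_num)
qed (auto intro: rstep.intros)

text \<open>Both inclusions matter: a new occurrence could violate a sharing condition, and a lost
  one would raise the workload of the enclosing \<open>Lam\<close>, which charges for the variables
  that do not occur.\<close>

lemma rstep_bound_at: "rstep \<Sigma> k M N \<Longrightarrow> bound_at i N = bound_at i M"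
proof (induction arbitrary: i rule: rstep.induct)
  case (rs_beta W P M)
  have "\<forall>V\<in>set (components P W). lcat 0 V"
    using components_closed rs_beta unfolding closed_term_def by blast
  then show ?case using rs_beta by (simp add: bound_at_opn closed_term_def bound_at_lcat_0)
next
  case (rs_num M N)
  then show ?case using numeric_rule_closed[OF rs_num]
    by (simp add: closed_term_def bound_at_lcat_0)
qed auto

lemma rstep_FV: "rstep \<Sigma> k M N \<Longrightarrow> FV N = FV M"
proof (induction rule: rstep.induct)
  case (rs_beta W P M)
  have "\<forall>V\<in>set (components P W). FV V = {}"
    using components_closed rs_beta unfolding closed_term_def by blast
  then show ?case using rs_beta by (simp add: FV_opn closed_term_def)
next
  case (rs_num M N)
  then show ?case using numeric_rule_closed[OF rs_num] by (simp add: closed_term_def)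
qed auto

section \<open>Termination by reducibility\<close>

lemma numeric_rule_App: "numeric_rule \<Sigma> M N \<Longrightarrow> \<exists>M\<^sub>1 M\<^sub>2. M = App M\<^sub>1 M\<^sub>2"
  by (auto elim: numeric_rule.cases)

lemma rstep_normal [simp]:
  "\<not> rstep \<Sigma> k (FVar x) N" "\<not> rstep \<Sigma> k (BVar i j) N" "\<not> rstep \<Sigma> k Unit N"
  "\<not> rstep \<Sigma> k WUnit N" "\<not> rstep \<Sigma> k (Num r) N" "\<not> rstep \<Sigma> k (Fn f) N"
  "\<not> rstep \<Sigma> k Plus N" "\<not> rstep \<Sigma> k Times N"
  by (auto elim!: rstep.cases dest: numeric_rule_App)

lemma rstep_Bang: "rstep \<Sigma> k (Bang M) X \<Longrightarrow> \<exists>M'. X = Bang M' \<and> rstep \<Sigma> k M M'"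
  by (erule rstep.cases) (auto dest: numeric_rule_App)

lemma rstep_Lam: "rstep \<Sigma> k (Lam P M) X \<Longrightarrow> \<exists>M'. X = Lam P M' \<and> rstep \<Sigma> k M M'"
  by (erule rstep.cases) (auto dest: numeric_rule_App)

lemma rstep_Pair:
  "rstep \<Sigma> k (Pair M N) X \<Longrightarrow>
     (\<exists>M'. X = Pair M' N \<and> rstep \<Sigma> k M M') \<or> (\<exists>N'. X = Pair M N' \<and> rstep \<Sigma> k N N')"
  by (erule rstep.cases) (auto dest: numeric_rule_App)

lemma rstep_WPair:
  "rstep \<Sigma> k (WPair M N) X \<Longrightarrow>
     (\<exists>M'. X = WPair M' N \<and> rstep \<Sigma> k M M') \<or> (\<exists>N'. X = WPair M N' \<and> rstep \<Sigma> k N N')"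
  by (erule rstep.cases) (auto dest: numeric_rule_App)

lemma rstep_App [consumes 1, case_names left right beta numeric]:
  assumes "rstep \<Sigma> k (App M N) X"
  obtains M' where "X = App M' N" "rstep \<Sigma> k M M'"
  | N' where "X = App M N'" "rstep \<Sigma> k N N'"
  | P M\<^sub>0 where "M = Lam P M\<^sub>0" "closed_term N" "matches P N" "X = opn 0 (components P N) M\<^sub>0"
  | "numeric_rule \<Sigma> (App M N) X"
  using assms by (cases rule: rstep.cases) auto

inductive SN :: "'f signature \<Rightarrow> 'f trm \<Rightarrow> bool" for \<Sigma> where
  SN_I: "(\<And>k N. rstep \<Sigma> k M N \<Longrightarrow> SN \<Sigma> N) \<Longrightarrow> SN \<Sigma> M"

lemma SN_step: "SN \<Sigma> M \<Longrightarrow> rstep \<Sigma> k M N \<Longrightarrow> SN \<Sigma> N"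
  by (erule SN.cases) auto

abbreviation reaches :: "'f signature \<Rightarrow> 'f trm \<Rightarrow> 'f trm \<Rightarrow> bool" where
  "reaches \<Sigma> \<equiv> (\<lambda>M N. \<exists>k. rstep \<Sigma> k M N)\<^sup>*\<^sup>*"

lemma reaches_Cons: "rstep \<Sigma> k M N \<Longrightarrow> reaches \<Sigma> N L \<Longrightarrow> reaches \<Sigma> M L"
  by (rule converse_rtranclp_into_rtranclp) auto

lemma reaches_snoc: "reaches \<Sigma> M N \<Longrightarrow> rstep \<Sigma> k N L \<Longrightarrow> reaches \<Sigma> M L"
  by (rule rtranclp.rtrancl_into_rtrancl) auto

text \<open>Girard's reducibility sets. The types \<open>TTensor\<close>, \<open>TWith\<close> and
  \<open>TBang\<close> are eliminated only by pattern matching, so they are interpreted through the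
  constructors that a term can reach.\<close>

fun RED :: "'f signature \<Rightarrow> ty \<Rightarrow> 'f trm \<Rightarrow> bool" where
  "RED \<Sigma> TReal M = SN \<Sigma> M"
| "RED \<Sigma> (TLolli A B) M = (SN \<Sigma> M \<and> (\<forall>N. RED \<Sigma> A N \<longrightarrow> RED \<Sigma> B (App M N)))"
| "RED \<Sigma> TOne M = SN \<Sigma> M"
| "RED \<Sigma> (TTensor A B) M =
     (SN \<Sigma> M \<and> (\<forall>V W. reaches \<Sigma> M (Pair V W) \<longrightarrow> RED \<Sigma> A V \<and> RED \<Sigma> B W))"
| "RED \<Sigma> TTop M = SN \<Sigma> M"
| "RED \<Sigma> (TWith A B) M =
     (SN \<Sigma> M \<and> (\<forall>V W. reaches \<Sigma> M (WPair V W) \<longrightarrow> RED \<Sigma> A V \<and> RED \<Sigma> B W))"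
| "RED \<Sigma> (TBang A) M = (SN \<Sigma> M \<and> (\<forall>V. reaches \<Sigma> M (Bang V) \<longrightarrow> RED \<Sigma> A V))"

text \<open>Terms that neither match a structured pattern nor interact with an argument. \<^term>\<open>App Times M\<close>
  does the latter.\<close>

fun neutral :: "'f trm \<Rightarrow> bool" where
  "neutral (App M N) = (M \<noteq> Times)"
| "neutral (FVar x) = True"
| "neutral (BVar i j) = True"
| "neutral Unit = True"
| "neutral WUnit = True"
| "neutral (Num r) = True"
| "neutral _ = False"

lemma RED_SN: "RED \<Sigma> A M \<Longrightarrow> SN \<Sigma> M"
  by (cases A) auto

lemma RED_step: "RED \<Sigma> A M \<Longrightarrow> rstep \<Sigma> k M N \<Longrightarrow> RED \<Sigma> A N"
proof (induction A arbitrary: M N)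
  case (TLolli A B)
  then have "RED \<Sigma> B (App N L)" if "RED \<Sigma> A L" for L
    using TLolli.IH(2)[of "App M L" "App N L"] that by (simp add: rs_App1)
  with TLolli.prems show ?case by (auto intro: SN_step)
qed (auto intro: SN_step dest: reaches_Cons)

lemma neutral_rstep_App:
  assumes "neutral M" "rstep \<Sigma> k (App M N) X"
  shows "(\<exists>M'. X = App M' N \<and> rstep \<Sigma> k M M') \<or> (\<exists>N'. X = App M N' \<and> rstep \<Sigma> k N N')"
  using assms(2)
proof (cases rule: rstep_App)
  case numeric
  then show ?thesis using assms(1) by (auto elim!: numeric_rule.cases)
qed (use assms(1) in auto)

text \<open>Girard's third closure condition. At an arrow type a neutral head leaves only steps
  inside the head or inside the argument, and the latter are handled by induction on the termination
  of the argument. At the types observed through \<open>reaches\<close>, a neutral term is not yet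
  the required constructor, so every path to one starts with a step.\<close>

lemma RED_neutral:
  "neutral M \<Longrightarrow> (\<And>k N. rstep \<Sigma> k M N \<Longrightarrow> RED \<Sigma> A N) \<Longrightarrow> RED \<Sigma> A M"
proof (induction A arbitrary: M)
  case (TLolli A B)
  have "RED \<Sigma> B (App M N)" if "SN \<Sigma> N" "RED \<Sigma> A N" for N
    using that
  proof (induction rule: SN.induct)
    case (SN_I N)
    show ?case
    proof (rule TLolli.IH(2))
      show "neutral (App M N)" using TLolli.prems(1) by auto
      show "RED \<Sigma> B X" if "rstep \<Sigma> k (App M N) X" for k X
        using neutral_rstep_App[OF TLolli.prems(1) that]
      proof (elim disjE exE conjE)
        fix N' assume "X = App M N'" "rstep \<Sigma> k N N'"
        then show ?thesis using SN_I RED_step by blast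
      next
        fix M' assume "X = App M' N" "rstep \<Sigma> k M M'"
        then show ?thesis using SN_I.prems TLolli.prems(2) by force
      qed
    qed
  qed
  moreover have "SN \<Sigma> M" using TLolli.prems(2) RED_SN by (blast intro: SN.intros)
  ultimately show ?case using RED_SN by auto
next
  case (TTensor A B)
  have "SN \<Sigma> M" using TTensor.prems(2) RED_SN by (blast intro: SN.intros)
  moreover have "RED \<Sigma> A V \<and> RED \<Sigma> B W" if "reaches \<Sigma> M (Pair V W)" for V W
    using that TTensor.prems by (cases rule: converse_rtranclpE) auto
  ultimately show ?case by auto
next
  case (TWith A B)
  have "SN \<Sigma> M" using TWith.prems(2) RED_SN by (blast intro: SN.intros)
  moreover have "RED \<Sigma> A V \<and> RED \<Sigma> B W" if "reaches \<Sigma> M (WPair V W)" for V W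
    using that TWith.prems by (cases rule: converse_rtranclpE) auto
  ultimately show ?case by auto
next
  case (TBang A)
  have "SN \<Sigma> M" using TBang.prems(2) RED_SN by (blast intro: SN.intros)
  moreover have "RED \<Sigma> A V" if "reaches \<Sigma> M (Bang V)" for V
    using that TBang.prems by (cases rule: converse_rtranclpE) auto
  ultimately show ?case by auto
qed (auto intro: SN.intros)

lemma RED_reaches: "reaches \<Sigma> M N \<Longrightarrow> RED \<Sigma> A M \<Longrightarrow> RED \<Sigma> A N"
  by (induction rule: rtranclp_induct) (auto intro: RED_step)

section \<open>Reducibility of constructors and constants\<close>

lemma SN_Num: "SN \<Sigma> (Num r)"
  by (auto intro: SN.intros)

lemma SN_Bang: "SN \<Sigma> M \<Longrightarrow> SN \<Sigma> (Bang M)"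
proof (induction rule: SN.induct)
  case (SN_I M)
  then show ?case using rstep_Bang by (metis SN.intros)
qed

lemma SN_Pair: "SN \<Sigma> M \<Longrightarrow> SN \<Sigma> N \<Longrightarrow> SN \<Sigma> (Pair M N)"
proof (induction arbitrary: N rule: SN.induct)
  case (SN_I M)
  note IH = SN_I(2)
  show ?case using SN_I.prems
  proof (induction rule: SN.induct)
    case (SN_I N)
    then have N: "SN \<Sigma> N" by (auto intro: SN.intros)
    show ?case
    proof (rule SN.intros)
      fix k X assume "rstep \<Sigma> k (Pair M N) X"
      then show "SN \<Sigma> X" using rstep_Pair IH N SN_I.IH by metis
    qed
  qed
qed

lemma SN_WPair: "SN \<Sigma> M \<Longrightarrow> SN \<Sigma> N \<Longrightarrow> SN \<Sigma> (WPair M N)"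
proof (induction arbitrary: N rule: SN.induct)
  case (SN_I M)
  note IH = SN_I(2)
  show ?case using SN_I.prems
  proof (induction rule: SN.induct)
    case (SN_I N)
    then have N: "SN \<Sigma> N" by (auto intro: SN.intros)
    show ?case
    proof (rule SN.intros)
      fix k X assume "rstep \<Sigma> k (WPair M N) X"
      then show "SN \<Sigma> X" using rstep_WPair IH N SN_I.IH by metis
    qed
  qed
qed

lemma reaches_Bang: "reaches \<Sigma> (Bang M) X \<Longrightarrow> \<exists>M'. X = Bang M' \<and> reaches \<Sigma> M M'"
proof (induction rule: rtranclp_induct)
  case (step Y Z)
  then show ?case by (auto dest!: rstep_Bang intro: reaches_snoc)
qed auto

lemma reaches_Pair:
  "reaches \<Sigma> (Pair M N) X \<Longrightarrow> \<exists>M' N'. X = Pair M' N' \<and> reaches \<Sigma> M M' \<and> reaches \<Sigma> N N'"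
proof (induction rule: rtranclp_induct)
  case (step Y Z)
  then show ?case by (auto dest!: rstep_Pair intro: reaches_snoc)
qed auto

lemma reaches_WPair:
  "reaches \<Sigma> (WPair M N) X \<Longrightarrow> \<exists>M' N'. X = WPair M' N' \<and> reaches \<Sigma> M M' \<and> reaches \<Sigma> N N'"
proof (induction rule: rtranclp_induct)
  case (step Y Z)
  then show ?case by (auto dest!: rstep_WPair intro: reaches_snoc)
qed auto

lemma RED_Bang: "RED \<Sigma> A M \<Longrightarrow> RED \<Sigma> (TBang A) (Bang M)"
  by (auto simp: RED_SN SN_Bang dest!: reaches_Bang intro: RED_reaches)

lemma RED_Pair: "RED \<Sigma> A M \<Longrightarrow> RED \<Sigma> B N \<Longrightarrow> RED \<Sigma> (TTensor A B) (Pair M N)"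
  by (auto simp: RED_SN SN_Pair dest!: reaches_Pair intro: RED_reaches)

lemma RED_WPair: "RED \<Sigma> A M \<Longrightarrow> RED \<Sigma> B N \<Longrightarrow> RED \<Sigma> (TWith A B) (WPair M N)"
  by (auto simp: RED_SN SN_WPair dest!: reaches_WPair intro: RED_reaches)

lemma RED_Num: "RED \<Sigma> A (Num r)"
  by (rule RED_neutral) auto

text \<open>Neutral and normal, hence reducible at every type. This makes \<open>Unit\<close> a
  filler for bound variables of arbitrary type.\<close>

lemma RED_Unit: "RED \<Sigma> A Unit"
  by (rule RED_neutral) auto

lemma RED_WUnit: "RED \<Sigma> A WUnit"
  by (rule RED_neutral) auto

text \<open>A numeric step yields \<open>Bang (Num r)\<close>, reducible at every
  \<open>TBang B\<close>, so termination is all that the argument has to provide.\<close>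

lemma RED_Fn: "RED \<Sigma> (TLolli A (TBang B)) (Fn f)"
proof -
  have "RED \<Sigma> (TBang B) (App (Fn f) N)" if "SN \<Sigma> N" for N
    using that
  proof (induction rule: SN.induct)
    case (SN_I N)
    show ?case
    proof (rule RED_neutral)
      fix k X assume "rstep \<Sigma> k (App (Fn f) N) X"
      then show "RED \<Sigma> (TBang B) X"
      proof (cases rule: rstep_App)
        case numeric
        then show ?thesis
          by (cases rule: numeric_rule.cases) (simp_all only: trm.inject trm.distinct RED_Bang RED_Num)
      qed (use SN_I in auto)
    qed simp
  qed
  then show ?thesis using RED_SN by (auto simp del: RED.simps(7) intro: SN.intros)
qed

lemma RED_Plus: "RED \<Sigma> (TLolli A B) Plus"
proof -
  have "RED \<Sigma> B (App Plus N)" if "SN \<Sigma> N" for N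
    using that
  proof (induction rule: SN.induct)
    case (SN_I N)
    show ?case
    proof (rule RED_neutral)
      fix k X assume "rstep \<Sigma> k (App Plus N) X"
      then show "RED \<Sigma> B X"
      proof (cases rule: rstep_App)
        case numeric
        then show ?thesis by (cases rule: numeric_rule.cases) (auto intro: RED_Num)
      qed (use SN_I in auto)
    qed simp
  qed
  then show ?thesis using RED_SN by (auto intro: SN.intros)
qed

lemma SN_App_Times: "SN \<Sigma> M \<Longrightarrow> SN \<Sigma> (App Times M)"
proof (induction rule: SN.induct)
  case (SN_I M)
  show ?case
  proof (rule SN.intros)
    fix k X assume "rstep \<Sigma> k (App Times M) X"
    then show "SN \<Sigma> X"
    proof (cases rule: rstep_App)
      case numeric
      then show ?thesis by (auto elim: numeric_rule.cases)
    qed (use SN_I in auto)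
  qed
qed

lemma SN_App_App_Times: "SN \<Sigma> M \<Longrightarrow> SN \<Sigma> N \<Longrightarrow> SN \<Sigma> (App (App Times M) N)"
proof (induction arbitrary: N rule: SN.induct)
  case (SN_I M)
  note IH = SN_I(2)
  show ?case using SN_I.prems
  proof (induction rule: SN.induct)
    case (SN_I N)
    from SN_I have N: "SN \<Sigma> N" by (auto intro: SN.intros)
    show ?case
    proof (rule SN.intros)
      fix k X assume "rstep \<Sigma> k (App (App Times M) N) X"
      then show "SN \<Sigma> X"
      proof (cases rule: rstep_App)
        case (left M')
        from left(2) show ?thesis
        proof (cases rule: rstep_App)
          case numeric
          then show ?thesis by (auto elim: numeric_rule.cases)
        qed (use left IH N in auto)
      next
        case numeric
        then show ?thesis by (cases rule: numeric_rule.cases) (auto intro: SN_Num)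
      qed (use SN_I in auto)
    qed
  qed
qed

text \<open>\<open>App Times M\<close> is not neutral, so \<open>RED_neutral\<close> does not cover
  it. Reducibility at \<open>TReal\<close> is termination, and unfolding leaves only termination
  claims for \<open>Times\<close> with zero, one and two arguments.\<close>

lemma RED_Times: "RED \<Sigma> (TLolli TReal (TLolli TReal TReal)) Times"
  by (auto intro: SN.intros SN_App_Times SN_App_App_Times)

text \<open>Opening maps each step of \<open>M\<close> to a step of the opened term, so termination
  is reflected.\<close>

lemma SN_opn:
  assumes "\<forall>V\<in>set Vs. lcat 0 V" "SN \<Sigma> (opn i Vs M)"
  shows "SN \<Sigma> M"
  using assms(2)
proof (induction "opn i Vs M" arbitrary: M rule: SN.induct)
  case SN_I
  then show ?case using rstep_opn[OF _ assms(1)] by (blast intro: SN.intros)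
qed

text \<open>Only closed matching arguments can fire the redex, so the second hypothesis concerns
  these alone; termination of the body is a separate hypothesis because steps also occur under the
  binder. The proof nests an induction on the argument in one on the body.\<close>

lemma RED_Lam:
  assumes "SN \<Sigma> M"
    and "\<And>W. closed_term W \<Longrightarrow> matches P W \<Longrightarrow> RED \<Sigma> A W \<Longrightarrow> RED \<Sigma> B (opn 0 (components P W) M)"
  shows "RED \<Sigma> (TLolli A B) (Lam P M)"
proof -
  have "RED \<Sigma> B (App (Lam P M) N)" if "SN \<Sigma> N" "RED \<Sigma> A N" for N
    using assms that
  proof (induction arbitrary: N rule: SN.induct)
    case (SN_I M)
    note IH = SN_I.IH and red = SN_I.prems(1)
    from SN_I.prems(2,3) show ?case
    proof (induction rule: SN.induct)
      case (SN_I N)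
      from SN_I have N: "SN \<Sigma> N" by (auto intro: SN.intros)
      show ?case
      proof (rule RED_neutral)
        fix k X assume "rstep \<Sigma> k (App (Lam P M) N) X"
        then show "RED \<Sigma> B X"
        proof (cases rule: rstep_App)
          case (left L)
          then obtain M' where X: "X = App (Lam P M') N" "rstep \<Sigma> k M M'"
            by (auto dest: rstep_Lam)
          \<comment> \<open>The hypothesis on opened bodies survives a step of the body, since
            opening turns that step into a step of the opened body.\<close>
          have "RED \<Sigma> B (opn 0 (components P W) M')"
            if W: "closed_term W" "matches P W" "RED \<Sigma> A W" for W
          proof (rule RED_step[OF red[OF W]])
            show "rstep \<Sigma> k (opn 0 (components P W) M) (opn 0 (components P W) M')"
              using X W components_closed[of P W] by (auto simp: closed_term_def intro!: rstep_opn)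
          qed
          then show ?thesis using IH[OF X(2)] N SN_I.prems X by blast
        next
          case (right N')
          then show ?thesis using SN_I RED_step by blast
        next
          case beta
          then show ?thesis using red SN_I.prems by auto
        next
          case numeric
          then show ?thesis by (auto elim: numeric_rule.cases)
        qed
      qed simp
    qed
  qed
  moreover have "SN \<Sigma> (Lam P M)"
    using assms(1)
  proof (induction rule: SN.induct)
    case (SN_I M)
    then show ?case using rstep_Lam by (metis SN.intros)
  qed
  ultimately show ?thesis using RED_SN by auto
qed

section \<open>Typing, affinity and safety without names\<close>

fun pat_ty :: "ty pat \<Rightarrow> ty" where
  "pat_ty (PVar A) = A"
| "pat_ty (PBang A) = TBang A"
| "pat_ty PUnit = TOne"
| "pat_ty (PPair p q) = TTensor (pat_ty p) (pat_ty q)"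
| "pat_ty (PWith p q) = TWith (pat_ty p) (pat_ty q)"

text \<open>The flag is set for the variables bound by an exponential pattern.\<close>

fun flagged :: "'v pat \<Rightarrow> (bool \<times> 'v) list" where
  "flagged (PVar x) = [(False, x)]"
| "flagged (PBang x) = [(True, x)]"
| "flagged PUnit = []"
| "flagged (PPair p q) = flagged p @ flagged q"
| "flagged (PWith p q) = flagged p @ flagged q"

text \<open>One judgement collects what safe reduction has to preserve. It is more permissive than the
  original typing: patterns in environments are flattened, and linear variables may be dropped.
  \<open>E\<close> is the set of named variables that may be duplicated, and the context lists
  the flagged types of the enclosing binders, innermost first.\<close>

inductive wt :: "'f signature \<Rightarrow> var set \<Rightarrow> (bool \<times> ty) list list \<Rightarrow> 'f trm \<Rightarrow> ty \<Rightarrow> bool"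
  for \<Sigma> E where
  wt_FVar: "wt \<Sigma> E G (FVar x) (snd x)"
| wt_BVar: "i < length G \<Longrightarrow> j < length (G ! i) \<Longrightarrow> wt \<Sigma> E G (BVar i j) (snd (G ! i ! j))"
| wt_Bang: "wt \<Sigma> E G M A \<Longrightarrow> workload M = 0 \<Longrightarrow> FV M \<subseteq> E \<Longrightarrow>
    (\<forall>i. \<forall>j\<in>bound_at i M. fst (G ! i ! j)) \<Longrightarrow> wt \<Sigma> E G (Bang M) (TBang A)"
| wt_Lam: "wt \<Sigma> E (flagged P # G) M B \<Longrightarrow> wt \<Sigma> E G (Lam P M) (TLolli (pat_ty P) B)"
| wt_App: "wt \<Sigma> E G M (TLolli A B) \<Longrightarrow> wt \<Sigma> E G N A \<Longrightarrow> FV M \<inter> FV N \<subseteq> E \<Longrightarrow>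
    (\<forall>i. \<forall>j\<in>bound_at i M \<inter> bound_at i N. fst (G ! i ! j)) \<Longrightarrow> wt \<Sigma> E G (App M N) B"
| wt_Unit: "wt \<Sigma> E G Unit TOne"
| wt_Pair: "wt \<Sigma> E G M A \<Longrightarrow> wt \<Sigma> E G N B \<Longrightarrow> FV M \<inter> FV N \<subseteq> E \<Longrightarrow>
    (\<forall>i. \<forall>j\<in>bound_at i M \<inter> bound_at i N. fst (G ! i ! j)) \<Longrightarrow>
    wt \<Sigma> E G (Pair M N) (TTensor A B)"
| wt_WUnit: "wt \<Sigma> E G WUnit TTop"
| wt_WPair: "wt \<Sigma> E G M A \<Longrightarrow> wt \<Sigma> E G N B \<Longrightarrow> (\<forall>x\<in>FV M \<inter> FV N. ground (snd x)) \<Longrightarrow>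
    (\<forall>i. \<forall>j\<in>bound_at i M \<inter> bound_at i N. ground (snd (G ! i ! j))) \<Longrightarrow>
    wt \<Sigma> E G (WPair M N) (TWith A B)"
| wt_Num: "wt \<Sigma> E G (Num r) TReal"
| wt_Fn: "wt \<Sigma> E G (Fn f) (TLolli (tensors (replicate (arity \<Sigma> f) (TBang TReal))) (TBang TReal))"
| wt_Plus: "wt \<Sigma> E G Plus (TLolli (TWith TReal TReal) TReal)"
| wt_Times: "wt \<Sigma> E G Times (TLolli TReal (TLolli TReal TReal))"

inductive_simps wt_simps:
  "wt \<Sigma> E G (Bang M) A" "wt \<Sigma> E G (Lam P M) A" "wt \<Sigma> E G (App M N) A" "wt \<Sigma> E G Unit A"
  "wt \<Sigma> E G (Pair M N) A" "wt \<Sigma> E G WUnit A" "wt \<Sigma> E G (WPair M N) A" "wt \<Sigma> E G (Num r) A"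
  "wt \<Sigma> E G (Fn f) A" "wt \<Sigma> E G Plus A" "wt \<Sigma> E G Times A"

lemma pat_ty_map: "pat_ty (map_pat snd p) = ptype p"
  by (induction p) auto

lemma map_snd_flagged: "map snd (flagged P) = pvars P"
  by (induction P) auto

lemma wt_lcat: "wt \<Sigma> E G M A \<Longrightarrow> lcat (length G) M"
  by (induction rule: wt.induct) auto

lemma take_nth_eq: "take k xs = take k ys \<Longrightarrow> i < k \<Longrightarrow> xs ! i = ys ! i"
  by (metis nth_take)

text \<open>The side conditions on shared bound variables all have the shape
  \<open>\<forall>i. \<forall>j\<in>bound_at i M \<inter> bound_at i N. P (G ! i ! j)\<close>, with \<open>M = N\<close> in the case of \<^const>\<open>Bang\<close>.\<close>

lemma shared_cong:
  assumes "lcat k M" "take k G = take k G'"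
    and "\<forall>i. \<forall>j\<in>bound_at i M \<inter> bound_at i N. P (G ! i ! j)"
  shows "\<forall>i. \<forall>j\<in>bound_at i M \<inter> bound_at i N. P (G' ! i ! j)"
proof (intro allI ballI)
  fix i j assume j: "j \<in> bound_at i M \<inter> bound_at i N"
  then have "i < k" using bound_at_lcat[OF assms(1), of i] by fastforce
  then have "G ! i = G' ! i" using take_nth_eq[OF assms(2)] by blast
  then show "P (G' ! i ! j)" using j assms(3) by metis
qed

text \<open>A term with \<open>lcat k\<close> mentions only the \<open>k\<close> innermost binders,
  and \<open>E\<close> matters only on its own names. With \<open>k = 0\<close>, closed values can
  be moved under any binders; with \<open>k = length G\<close>, the set \<open>E\<close> can be
  changed.\<close>

lemma wt_cong:
  assumes "wt \<Sigma> E G M A" "lcat k M" "take k G = take k G'" "E \<inter> FV M \<subseteq> E'"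
  shows "wt \<Sigma> E' G' M A"
  using assms
proof (induction arbitrary: k G' rule: wt.induct)
  case (wt_BVar i G j)
  then have "min (length G) k = min (length G') k" by (metis length_take)
  then have "i < length G'" using wt_BVar by auto
  moreover have "G ! i = G' ! i" using wt_BVar take_nth_eq[of k G G' i] by auto
  ultimately show ?case using wt_BVar wt.wt_BVar[of i G' j] by auto
next
  case (wt_Lam P G M B)
  then show ?case using wt_Lam.IH[of "Suc k" "flagged P # G'"] by (auto intro: wt.wt_Lam)
next
  case (wt_Bang G M A)
  have "wt \<Sigma> E' G' M A" using wt_Bang.IH[of k G'] wt_Bang.prems by auto
  moreover have "FV M \<subseteq> E'" using wt_Bang.hyps wt_Bang.prems by auto
  moreover have "\<forall>i. \<forall>j\<in>bound_at i M. fst (G' ! i ! j)"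
    using shared_cong[of k M G G' M fst] wt_Bang.hyps wt_Bang.prems by simp
  ultimately show ?case using wt_Bang.hyps by (intro wt.wt_Bang)
next
  case (wt_App G M A B N)
  have "wt \<Sigma> E' G' M (TLolli A B)" "wt \<Sigma> E' G' N A"
    using wt_App.IH[of k G'] wt_App.prems by auto
  moreover have "FV M \<inter> FV N \<subseteq> E'" using wt_App.hyps wt_App.prems by auto
  moreover have "\<forall>i. \<forall>j\<in>bound_at i M \<inter> bound_at i N. fst (G' ! i ! j)"
    using shared_cong[of k M G G' N fst] wt_App.hyps wt_App.prems by simp
  ultimately show ?case by (rule wt.wt_App)
next
  case (wt_Pair G M A N B)
  have "wt \<Sigma> E' G' M A" "wt \<Sigma> E' G' N B"
    using wt_Pair.IH[of k G'] wt_Pair.prems by auto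
  moreover have "FV M \<inter> FV N \<subseteq> E'" using wt_Pair.hyps wt_Pair.prems by auto
  moreover have "\<forall>i. \<forall>j\<in>bound_at i M \<inter> bound_at i N. fst (G' ! i ! j)"
    using shared_cong[of k M G G' N fst] wt_Pair.hyps wt_Pair.prems by simp
  ultimately show ?case by (rule wt.wt_Pair)
next
  case (wt_WPair G M A N B)
  have "wt \<Sigma> E' G' M A" "wt \<Sigma> E' G' N B"
    using wt_WPair.IH[of k G'] wt_WPair.prems by auto
  moreover have "\<forall>i. \<forall>j\<in>bound_at i M \<inter> bound_at i N. ground (snd (G' ! i ! j))"
    using shared_cong[of k M G G' N "\<lambda>b. ground (snd b)"] wt_WPair.hyps wt_WPair.prems by simp
  ultimately show ?case using wt_WPair.hyps by (intro wt.wt_WPair)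
qed (auto intro: wt.intros)

lemma wt_closed: "wt \<Sigma> E G M A \<Longrightarrow> closed_term M \<Longrightarrow> wt \<Sigma> E' G' M A"
  by (rule wt_cong[where k = 0]) (auto simp: closed_term_def)

lemma bound_at_close_last:
  assumes "lcat k M" "j \<in> bound_at i (close k xs M)"
  shows "i < k \<and> j \<in> bound_at i M \<or> i = k \<and> (\<exists>x\<in>FV M \<inter> set xs. j = pos x xs)"
proof (cases "i < k")
  case False
  then show ?thesis using assms by (auto simp: bound_at_close bound_at_lcat split: if_splits)
qed (use assms in \<open>auto simp: bound_at_close\<close>)

lemma pos_inj: "x \<in> set xs \<Longrightarrow> y \<in> set xs \<Longrightarrow> pos x xs = pos y xs \<Longrightarrow> x = y"
  by (metis nth_pos)

text \<open>A position shared at the new binder comes from a name shared before closing, because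
  \<open>pos\<close> is injective on the members of \<open>xs\<close>. Conditions on names thus
  become conditions on positions.\<close>

lemma shared_close:
  assumes "lcat (length G) M" "lcat (length G) N"
    and "\<forall>i. \<forall>j\<in>bound_at i M \<inter> bound_at i N. P (G ! i ! j)"
    and "\<forall>x\<in>FV M \<inter> FV N. P (f x)"
  shows "\<forall>i. \<forall>j\<in>bound_at i (close (length G) xs M) \<inter> bound_at i (close (length G) xs N).
     P ((G @ [map f xs]) ! i ! j)"
proof (intro allI ballI)
  fix i j
  assume j: "j \<in> bound_at i (close (length G) xs M) \<inter> bound_at i (close (length G) xs N)"
  show "P ((G @ [map f xs]) ! i ! j)"
  proof (cases "i < length G")
    case True
    then show ?thesis using j assms(3) by (auto simp: nth_append bound_at_close)
  next
    case False
    obtain x where x: "i = length G" "x \<in> FV M" "x \<in> set xs" "j = pos x xs"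
      using j False bound_at_close_last[OF assms(1)] by blast
    obtain y where y: "y \<in> FV N" "y \<in> set xs" "j = pos y xs"
      using j False bound_at_close_last[OF assms(2)] by blast
    have "x = y" using x y pos_inj by metis
    then have "P (f x)" using x y assms(4) by blast
    then show ?thesis using x by (simp add: pos_less nth_pos)
  qed
qed

text \<open>The names in \<open>xs\<close> become the outermost binder, hence the last entry of a
  context listed innermost first; the flags record membership in \<open>E\<close>.\<close>

lemma wt_close:
  assumes "wt \<Sigma> E G M A"
  shows "wt \<Sigma> (E - set xs) (G @ [map (\<lambda>x. (x \<in> E, snd x)) xs]) (close (length G) xs M) A"
  using assms
proof (induction rule: wt.induct)
  case (wt_FVar G x)
  show ?case
  proof (cases "x \<in> set xs")
    case True
    then show ?thesis
      using wt.wt_BVar[of "length G" "G @ [map (\<lambda>x. (x \<in> E, snd x)) xs]" "pos x xs" \<Sigma> "E - set xs"]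
      by (simp add: pos_less nth_pos)
  qed (auto intro: wt.wt_FVar)
next
  case (wt_BVar i G j)
  then show ?case
    using wt.wt_BVar[of i "G @ [map (\<lambda>x. (x \<in> E, snd x)) xs]" j \<Sigma> "E - set xs"]
    by (simp add: nth_append)
next
  case (wt_Bang G M A)
  have "lcat (length G) M" using wt_Bang wt_lcat by blast
  then show ?case unfolding close.simps
    using wt_Bang.hyps shared_close[of G M M fst "\<lambda>x. (x \<in> E, snd x)" xs]
    by (intro wt.wt_Bang[OF wt_Bang.IH]) (auto simp: workload_close FV_close)
next
  case (wt_Lam P G M B)
  then show ?case by (auto intro: wt.wt_Lam)
next
  case (wt_App G M A B N)
  have "lcat (length G) M" "lcat (length G) N" using wt_App wt_lcat by blast+
  then show ?case unfolding close.simps using wt_App.hyps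
    by (intro wt.wt_App[OF wt_App.IH] shared_close) (auto simp: FV_close)
next
  case (wt_Pair G M A N B)
  have "lcat (length G) M" "lcat (length G) N" using wt_Pair wt_lcat by blast+
  then show ?case unfolding close.simps using wt_Pair.hyps
    by (intro wt.wt_Pair[OF wt_Pair.IH] shared_close) (auto simp: FV_close)
next
  case (wt_WPair G M A N B)
  have "lcat (length G) M" "lcat (length G) N" using wt_WPair wt_lcat by blast+
  then show ?case unfolding close.simps
    using wt_WPair.hyps shared_close[of G M N "\<lambda>b. ground (snd b)" "\<lambda>x. (x \<in> E, snd x)" xs]
    by (intro wt.wt_WPair[OF wt_WPair.IH]) (auto simp: FV_close)
qed (auto intro: wt.intros)

section \<open>Subject reduction and decrease of the workload\<close>

lemma finite_bound_at: "finite (bound_at k M)"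
  by (induction M arbitrary: k) auto

lemma shared_opn:
  assumes "\<forall>V\<in>set Vs. lcat 0 V"
    and "\<forall>i. \<forall>j\<in>bound_at i M \<inter> bound_at i N. P ((G @ T # G') ! i ! j)"
  shows "\<forall>i. \<forall>j\<in>bound_at i (opn (length G) Vs M) \<inter> bound_at i (opn (length G) Vs N).
     P ((G @ G') ! i ! j)"
proof (intro allI ballI)
  fix i j
  assume j: "j \<in> bound_at i (opn (length G) Vs M) \<inter> bound_at i (opn (length G) Vs N)"
  show "P ((G @ G') ! i ! j)"
  proof (cases "i < length G")
    case True
    then show ?thesis using j assms(2)[rule_format, of j i]
      by (simp add: bound_at_opn[OF assms(1)] nth_append)
  next
    case False
    then show ?thesis using j assms(2)[rule_format, of j "Suc i"]
      by (simp add: bound_at_opn[OF assms(1)] nth_append Suc_diff_le)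
  qed
qed

lemma sum_Un_shared:
  fixes f :: "'a \<Rightarrow> nat"
  assumes "finite A" "finite B" "\<forall>x\<in>A \<inter> B. f x = 0"
  shows "sum f (A \<union> B) = sum f A + sum f B"
  using sum.union_inter[OF assms(1,2), of f] assms(3) by simp

text \<open>The sum runs over a set of positions, so every component counts once. It is additive
  over subterms since shared positions are flagged (\<open>App\<close>, \<open>Pair\<close>) or of
  ground type (\<open>WPair\<close>), and \<open>free\<close> gives both kinds workload 0.\<close>

lemma wt_opn:
  assumes "wt \<Sigma> E H M A" "H = G @ Ts # G'"
    and closed: "\<forall>V\<in>set Vs. closed_term V"
    and typed: "list_all2 (\<lambda>T V. wt \<Sigma> E [] V (snd T)) Ts Vs"
    and free: "\<And>j. fst (Ts ! j) \<or> ground (snd (Ts ! j)) \<Longrightarrow> workload (nth_or_unit Vs j) = 0"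
  shows "wt \<Sigma> E (G @ G') (opn (length G) Vs M) A \<and>
    workload (opn (length G) Vs M) \<le>
      workload M + (\<Sum>j\<in>bound_at (length G) M. workload (nth_or_unit Vs j))"
proof -
  have lcat: "\<forall>V\<in>set Vs. lcat 0 V" and FV: "\<forall>V\<in>set Vs. FV V = {}"
    using closed by (auto simp: closed_term_def)
  have nth: "(G @ Ts # G') ! length G = Ts" for G by simp
  show ?thesis
    using assms(1,2)
  proof (induction arbitrary: G rule: wt.induct)
    case (wt_BVar i H j)
    consider "i < length G" | "i = length G" | "i > length G" by linarith
    then show ?case
    proof cases
      case 1
      then show ?thesis using wt_BVar wt.wt_BVar[of i "G @ G'" j \<Sigma> E]
        by (auto simp: nth_append)
    next
      case 2
      then have j: "j < length Ts" using wt_BVar by simp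
      then have V: "wt \<Sigma> E [] (Vs ! j) (snd (Ts ! j))" "j < length Vs"
        using typed by (auto simp: list_all2_conv_all_nth)
      then have "wt \<Sigma> E (G @ G') (Vs ! j) (snd (Ts ! j))" using closed wt_closed by force
      then show ?thesis using 2 V wt_BVar by (simp add: nth_or_unit_def)
    next
      case 3
      then show ?thesis using wt_BVar wt.wt_BVar[of "i - 1" "G @ G'" j \<Sigma> E]
        by (cases i) (auto simp: nth_append Suc_diff_le)
    qed
  next
    case (wt_Bang H M A)
    \<comment> \<open>Everything occurring under the \<open>Bang\<close> is flagged, so opening
      keeps the content at workload 0.\<close>
    have "\<forall>j\<in>bound_at (length G) M. workload (nth_or_unit Vs j) = 0"
      using wt_Bang.hyps(4)[rule_format, of _ "length G"] free wt_Bang.prems by simp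
    then have "workload (opn (length G) Vs M) = 0"
      using wt_Bang.IH[OF wt_Bang.prems] wt_Bang.hyps by simp
    moreover have "\<forall>i. \<forall>j\<in>bound_at i (opn (length G) Vs M). fst ((G @ G') ! i ! j)"
      using shared_opn[OF lcat, of M M fst G Ts G'] wt_Bang.hyps wt_Bang.prems by simp
    ultimately show ?case using wt_Bang.IH[OF wt_Bang.prems] wt_Bang.hyps
      by (auto simp: FV_opn[OF FV] intro!: wt.wt_Bang)
  next
    case (wt_Lam P H M B)
    then show ?case using wt_Lam.IH[of "flagged P # G"]
      by (auto simp: bound_at_opn[OF lcat] intro!: wt.wt_Lam)
  next
    case (wt_App H M A B N)
    \<comment> \<open>Without cost on the intersection, the sums for \<open>M\<close> and
      \<open>N\<close> add up to the sum over the union.\<close>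
    have "\<forall>j\<in>bound_at (length G) M \<inter> bound_at (length G) N. workload (nth_or_unit Vs j) = 0"
      using wt_App.hyps(4)[rule_format, of _ "length G"] free wt_App.prems by simp
    note sum = sum_Un_shared[OF finite_bound_at finite_bound_at this]
    have "\<forall>i. \<forall>j\<in>bound_at i (opn (length G) Vs M) \<inter> bound_at i (opn (length G) Vs N).
        fst ((G @ G') ! i ! j)"
      using shared_opn[OF lcat, of M N fst G Ts G'] wt_App.hyps wt_App.prems by simp
    then have "wt \<Sigma> E (G @ G') (opn (length G) Vs (App M N)) B"
      using wt_App.IH[OF wt_App.prems] wt_App.hyps(3) unfolding opn.simps
      by (intro wt.wt_App[of _ _ _ _ A]) (auto simp: FV_opn[OF FV])
    then show ?case using wt_App.IH[OF wt_App.prems] sum by simp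
  next
    case (wt_Pair H M A N B)
    have "\<forall>j\<in>bound_at (length G) M \<inter> bound_at (length G) N. workload (nth_or_unit Vs j) = 0"
      using wt_Pair.hyps(4)[rule_format, of _ "length G"] free wt_Pair.prems by simp
    note sum = sum_Un_shared[OF finite_bound_at finite_bound_at this]
    have "\<forall>i. \<forall>j\<in>bound_at i (opn (length G) Vs M) \<inter> bound_at i (opn (length G) Vs N).
        fst ((G @ G') ! i ! j)"
      using shared_opn[OF lcat, of M N fst G Ts G'] wt_Pair.hyps wt_Pair.prems by simp
    then have "wt \<Sigma> E (G @ G') (opn (length G) Vs (Pair M N)) (TTensor A B)"
      using wt_Pair.IH[OF wt_Pair.prems] wt_Pair.hyps(3) unfolding opn.simps
      by (intro wt.wt_Pair) (auto simp: FV_opn[OF FV])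
    then show ?case using wt_Pair.IH[OF wt_Pair.prems] sum by simp
  next
    case (wt_WPair H M A N B)
    have "\<forall>j\<in>bound_at (length G) M \<inter> bound_at (length G) N. workload (nth_or_unit Vs j) = 0"
      using wt_WPair.hyps(4)[rule_format, of _ "length G"] free wt_WPair.prems by simp
    note sum = sum_Un_shared[OF finite_bound_at finite_bound_at this]
    have "\<forall>i. \<forall>j\<in>bound_at i (opn (length G) Vs M) \<inter> bound_at i (opn (length G) Vs N).
        ground (snd ((G @ G') ! i ! j))"
      using shared_opn[OF lcat, of M N "\<lambda>b. ground (snd b)" G Ts G'] wt_WPair.hyps wt_WPair.prems
      by simp
    then have "wt \<Sigma> E (G @ G') (opn (length G) Vs (WPair M N)) (TWith A B)"
      using wt_WPair.IH[OF wt_WPair.prems] wt_WPair.hyps(3) unfolding opn.simps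
      by (intro wt.wt_WPair) (auto simp: FV_opn[OF FV])
    then show ?case using wt_WPair.IH[OF wt_WPair.prems] sum by simp
  qed (auto intro: wt.intros)
qed

text \<open>A flagged component is the content of a \<open>Bang\<close>, and typing of
  \<open>Bang\<close> demands workload 0 there.\<close>

lemma components_wt:
  "matches P W \<Longrightarrow> wt \<Sigma> E G W (pat_ty P) \<Longrightarrow>
     list_all2 (\<lambda>T V. wt \<Sigma> E G V (snd T) \<and> (fst T \<longrightarrow> workload V = 0)) (flagged P) (components P W)"
  by (induction P W rule: matches.induct) (auto simp: wt_simps intro!: list_all2_appendI)

lemma workload_components:
  "matches P W \<Longrightarrow> wt \<Sigma> E G W (pat_ty P) \<Longrightarrow>
     sum_list (map workload (components P W)) \<le> workload W"
  by (induction P W rule: matches.induct) (fastforce simp: wt_simps)+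

text \<open>The constants of workload 1, abstractions and \<open>App Times V\<close> all have arrow
  types, so none of them occurs in a strong value of ground type.\<close>

lemma ground_value_workload:
  "strong_value V \<Longrightarrow> wt \<Sigma> E G V A \<Longrightarrow> ground A \<Longrightarrow> workload V = 0"
  by (induction V arbitrary: A rule: strong_value.induct) (auto simp: wt_simps)

lemma sum_workload_le:
  assumes "finite S"
  shows "(\<Sum>j\<in>S. workload (nth_or_unit Vs j)) \<le> sum_list (map workload Vs)"
proof -
  have "(\<Sum>j\<in>S. workload (nth_or_unit Vs j)) = (\<Sum>j\<in>S \<inter> {..<length Vs}. workload (nth_or_unit Vs j))"
    using assms by (intro sum.mono_neutral_right) (auto simp: nth_or_unit_def)
  also have "\<dots> \<le> (\<Sum>j<length Vs. workload (nth_or_unit Vs j))"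
    by (intro sum_mono2) auto
  also have "\<dots> = sum_list (map workload Vs)"
    by (simp add: sum_list_sum_nth nth_or_unit_def atLeast0LessThan)
  finally show ?thesis .
qed

lemma wt_beta:
  assumes "wt \<Sigma> E G (App (Lam P M) W) B" "closed_term W" "strong_value W" "matches P W"
  shows "wt \<Sigma> E G (opn 0 (components P W) M) B \<and>
    workload (opn 0 (components P W) M) \<le> workload M + workload W"
proof -
  let ?Vs = "components P W"
  have M: "wt \<Sigma> E (flagged P # G) M B" and W: "wt \<Sigma> E G W (pat_ty P)"
    using assms(1) by (auto simp: wt_simps)
  have W0: "wt \<Sigma> E [] W (pat_ty P)" using W assms(2) by (rule wt_closed)
  have all: "list_all2 (\<lambda>T V. wt \<Sigma> E [] V (snd T) \<and> (fst T \<longrightarrow> workload V = 0)) (flagged P) ?Vs"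
    using components_wt[OF assms(4) W0] .
  \<comment> \<open>Flagged components are free by typing; those of ground type are free because
    they are strong values.\<close>
  have "workload (nth_or_unit ?Vs j) = 0"
    if "fst (flagged P ! j) \<or> ground (snd (flagged P ! j))" for j
  proof (cases "j < length ?Vs")
    case True
    then have "wt \<Sigma> E [] (?Vs ! j) (snd (flagged P ! j))"
        "fst (flagged P ! j) \<longrightarrow> workload (?Vs ! j) = 0" "strong_value (?Vs ! j)"
      using all components_strong_value[OF assms(4,3)] by (auto simp: list_all2_conv_all_nth)
    then show ?thesis using that True ground_value_workload by (auto simp: nth_or_unit_def)
  qed (simp add: nth_or_unit_def)
  moreover have "list_all2 (\<lambda>T V. wt \<Sigma> E [] V (snd T)) (flagged P) ?Vs"
    using all by (rule list_all2_mono) auto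
  moreover have "\<forall>V\<in>set ?Vs. closed_term V" using components_closed[OF assms(4,2)] by blast
  ultimately have "wt \<Sigma> E G (opn 0 ?Vs M) B \<and>
      workload (opn 0 ?Vs M) \<le> workload M + (\<Sum>j\<in>bound_at 0 M. workload (nth_or_unit ?Vs j))"
    using wt_opn[OF M, of "[]" "flagged P" G ?Vs] by simp
  moreover have "(\<Sum>j\<in>bound_at 0 M. workload (nth_or_unit ?Vs j)) \<le> workload W"
    using sum_workload_le[OF finite_bound_at] workload_components[OF assms(4) W]
    by (rule order_trans)
  ultimately show ?thesis by linarith
qed

lemma wt_rstep:
  assumes "rstep \<Sigma> k M N" "wt \<Sigma> E G M A"
  shows "wt \<Sigma> E G N A \<and> workload N + (if k = Numeric then 1 else 0) \<le> workload M"
  using assms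
proof (induction arbitrary: G A rule: rstep.induct)
  case (rs_beta W P M)
  then show ?case using wt_beta[of \<Sigma> E G P M W A] by simp
next
  case (rs_num M N)
  \<comment> \<open>Each numeric redex contains exactly one constant of workload 1, and its result
    has workload 0.\<close>
  then show ?case by (auto elim!: numeric_rule.cases simp: wt_simps intro!: wt.wt_Num)
next
  case (rs_Lam k M M' P)
  \<comment> \<open>The charge for absent variables is the same before and after the step.\<close>
  then show ?case using rstep_bound_at[OF rs_Lam.hyps] by (auto simp: wt_simps)
next
  case (rs_Bang k M M')
  \<comment> \<open>The content has workload 0, so a numeric step contradicts the induction
    hypothesis.\<close>
  then show ?case using rstep_bound_at[OF rs_Bang.hyps] rstep_FV[OF rs_Bang.hyps]
    by (fastforce simp: wt_simps)
next
  case (rs_App1 k M M' N)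
  then show ?case using rstep_bound_at[OF rs_App1.hyps] rstep_FV[OF rs_App1.hyps]
    by (fastforce simp: wt_simps)
next
  case (rs_App2 k M M' N)
  then show ?case using rstep_bound_at[OF rs_App2.hyps] rstep_FV[OF rs_App2.hyps]
    by (fastforce simp: wt_simps)
next
  case (rs_Pair1 k M M' N)
  then show ?case using rstep_bound_at[OF rs_Pair1.hyps] rstep_FV[OF rs_Pair1.hyps]
    by (fastforce simp: wt_simps)
next
  case (rs_Pair2 k M M' N)
  then show ?case using rstep_bound_at[OF rs_Pair2.hyps] rstep_FV[OF rs_Pair2.hyps]
    by (fastforce simp: wt_simps)
next
  case (rs_WPair1 k M M' N)
  then show ?case using rstep_bound_at[OF rs_WPair1.hyps] rstep_FV[OF rs_WPair1.hyps]
    by (fastforce simp: wt_simps)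
next
  case (rs_WPair2 k M M' N)
  then show ?case using rstep_bound_at[OF rs_WPair2.hyps] rstep_FV[OF rs_WPair2.hyps]
    by (fastforce simp: wt_simps)
qed

section \<open>From the original typing\<close>

text \<open>Exponential patterns nested inside pairs count as well, so the set is unchanged when
  \<open>T_PairL\<close> packs two patterns into one.\<close>

definition expvars :: "var pat set \<Rightarrow> var set" where
  "expvars \<Delta> = {x. \<exists>p\<in>\<Delta>. (True, x) \<in> set (flagged p)}"

lemma wt_mono: "wt \<Sigma> E G M A \<Longrightarrow> E \<inter> FV M \<subseteq> E' \<Longrightarrow> wt \<Sigma> E' G M A"
  by (rule wt_cong[where k = "length G"]) (auto intro: wt_lcat)

lemma flagged_pvars: "(b, x) \<in> set (flagged p) \<Longrightarrow> x \<in> set (pvars p)"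
  by (induction p) auto

lemma flagged_map: "flagged (map_pat f p) = map (\<lambda>(b, x). (b, f x)) (flagged p)"
  by (induction p) auto

lemma expvars_subset: "expvars \<Delta> \<subseteq> evars \<Delta>"
  by (auto simp: expvars_def evars_def dest: flagged_pvars)

lemma exponential_expvars: "exponential \<Gamma> \<Longrightarrow> evars \<Gamma> \<subseteq> expvars \<Gamma>"
  by (force simp: exponential_def expvars_def evars_def)

lemma expvars_Un: "expvars (\<Gamma> \<union> \<Delta>) = expvars \<Gamma> \<union> expvars \<Delta>"
  by (auto simp: expvars_def)

lemma evars_Un: "evars (\<Gamma> \<union> \<Delta>) = evars \<Gamma> \<union> evars \<Delta>"
  by (auto simp: evars_def)

lemma typing_FV: "typing \<Sigma> \<Delta> M A \<Longrightarrow> FV M \<subseteq> evars \<Delta>"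
  by (induction rule: typing.induct) (auto simp: evars_def FV_lam)

lemma shared_FV:
  assumes "typing \<Sigma> (\<Gamma>\<^sub>1 \<union> \<Delta>\<^sub>1) M A" "typing \<Sigma> (\<Gamma>\<^sub>2 \<union> \<Delta>\<^sub>2) N B"
    "exponential \<Gamma>\<^sub>1" "exponential \<Gamma>\<^sub>2"
    "apart (\<Gamma>\<^sub>1 \<union> \<Gamma>\<^sub>2) \<Delta>\<^sub>1" "apart (\<Gamma>\<^sub>1 \<union> \<Gamma>\<^sub>2) \<Delta>\<^sub>2" "apart \<Delta>\<^sub>1 \<Delta>\<^sub>2"
  shows "FV M \<inter> FV N \<subseteq> expvars (\<Gamma>\<^sub>1 \<union> \<Gamma>\<^sub>2 \<union> \<Delta>\<^sub>1 \<union> \<Delta>\<^sub>2)"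
  using typing_FV[OF assms(1)] typing_FV[OF assms(2)] assms(5-7)
    exponential_expvars[OF assms(3)] exponential_expvars[OF assms(4)]
  unfolding evars_Un expvars_Un apart_def by blast

text \<open>Linearity of \<open>p\<close> gives each of its variables a single flag, and the second
  hypothesis prevents \<Delta> from making one of them exponential.\<close>

lemma flagged_expvars:
  assumes "pattern p" "expvars \<Delta> \<inter> set (pvars p) = {}"
  shows "map (\<lambda>x. (x \<in> expvars (insert p \<Delta>), snd x)) (pvars p) = flagged (map_pat snd p)"
proof -
  have inj: "inj_on snd (set (flagged p))"
    using assms(1) by (auto simp: pattern_def map_snd_flagged[symmetric] distinct_map)
  have "(x \<in> expvars (insert p \<Delta>)) = b" if b: "(b, x) \<in> set (flagged p)" for b x
  proof
    assume "x \<in> expvars (insert p \<Delta>)"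
    then have "(True, x) \<in> set (flagged p)"
      using assms(2) flagged_pvars[OF b] by (auto simp: expvars_def)
    then show b using inj_onD[OF inj, of "(b, x)" "(True, x)"] b by simp
  qed (use b in \<open>auto simp: expvars_def\<close>)
  then show ?thesis
    unfolding flagged_map map_snd_flagged[symmetric] by auto
qed

lemma wt_lam:
  assumes "wt \<Sigma> (expvars (insert p \<Delta>)) [] M B" "pattern p" "apart {p} \<Delta>"
  shows "wt \<Sigma> (expvars \<Delta>) [] (lam p M) (TLolli (ptype p) B)"
proof -
  have "expvars \<Delta> \<inter> set (pvars p) = {}"
    using assms(3) expvars_subset[of \<Delta>] by (auto simp: apart_def evars_def)
  then have "wt \<Sigma> (expvars (insert p \<Delta>) - set (pvars p)) [flagged (map_pat snd p)]
      (close 0 (pvars p) M) B"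
    using wt_close[OF assms(1), of "pvars p"] flagged_expvars[OF assms(2)] by simp
  moreover have "expvars (insert p \<Delta>) - set (pvars p) \<subseteq> expvars \<Delta>"
    using flagged_pvars[of True _ p] by (auto simp: expvars_def)
  ultimately have "wt \<Sigma> (expvars \<Delta>) [flagged (map_pat snd p)] (close 0 (pvars p) M) B"
    by (auto intro: wt_mono)
  then show ?thesis
    unfolding lam_def pat_ty_map[symmetric] by (rule wt.wt_Lam)
qed

lemma safe_term_subterm:
  "safe_term M \<Longrightarrow> (\<And>L. subterm L N \<Longrightarrow> subterm L M) \<Longrightarrow> safe_term N"
  unfolding safe_term_def by blast

text \<open>In the empty context every variable that is not yet bound is a name. Typed terms are
  locally closed, so the conditions on positions are vacuous here and only those on names have to be
  derived; \<open>wt_close\<close> converts them at each abstraction.\<close>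

lemma typing_wt:
  "typing \<Sigma> \<Delta> M A \<Longrightarrow> safe_term M \<Longrightarrow> wt \<Sigma> (expvars \<Delta>) [] M A"
proof (induction rule: typing.induct)
  case (T_Bang \<Gamma> M A)
  have "FV M \<subseteq> expvars \<Gamma>"
    using typing_FV[OF T_Bang.hyps(1)] exponential_expvars[OF T_Bang.hyps(2)] by blast
  moreover have "workload M = 0"
    using T_Bang.prems subterm.intros(1)[of "Bang M"] unfolding safe_term_def by blast
  moreover have "safe_term M"
    using T_Bang.prems by (rule safe_term_subterm) (rule subterm.intros)
  moreover have "bound_at i M = {}" for i
    using T_Bang.hyps(1) typing_lc_env bound_at_lc by blast
  ultimately show ?case using T_Bang.IH by (intro wt.wt_Bang) auto
next
  case (T_Weak \<Delta> M B x)
  then have "wt \<Sigma> (expvars \<Delta>) [] M B" by simp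
  then show ?case by (rule wt_mono) (auto simp: expvars_def)
next
  case (T_Lam p \<Delta> M B)
  have p: "pattern p" "lc M" using typing_lc_env[OF T_Lam.hyps(1)] env_insertD by auto
  have "safe_term M"
    using T_Lam.prems by (rule safe_term_subterm) (rule subterm.intros(3)[OF _ p])
  then show ?case using T_Lam.IH T_Lam.hyps(2) p(1) by (intro wt_lam)
next
  case (T_App \<Gamma>\<^sub>1 \<Delta>\<^sub>1 M A B \<Gamma>\<^sub>2 \<Delta>\<^sub>2 N)
  have "safe_term M"
    using T_App.prems by (rule safe_term_subterm) (rule subterm.intros(4))
  moreover have "safe_term N"
    using T_App.prems by (rule safe_term_subterm) (rule subterm.intros(5))
  ultimately have "wt \<Sigma> (expvars (\<Gamma>\<^sub>1 \<union> \<Delta>\<^sub>1)) [] M (TLolli A B)" "wt \<Sigma> (expvars (\<Gamma>\<^sub>2 \<union> \<Delta>\<^sub>2)) [] N A"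
    using T_App.IH by auto
  then have "wt \<Sigma> (expvars (\<Gamma>\<^sub>1 \<union> \<Gamma>\<^sub>2 \<union> \<Delta>\<^sub>1 \<union> \<Delta>\<^sub>2)) [] M (TLolli A B)"
      "wt \<Sigma> (expvars (\<Gamma>\<^sub>1 \<union> \<Gamma>\<^sub>2 \<union> \<Delta>\<^sub>1 \<union> \<Delta>\<^sub>2)) [] N A"
    by - (erule wt_mono, auto simp: expvars_Un)+
  moreover have "bound_at i M = {}" for i
    using T_App.hyps(1) typing_lc_env bound_at_lc by blast
  ultimately show ?case using shared_FV[OF T_App.hyps(1,2)] T_App.hyps
    by (intro wt.wt_App) auto
next
  case (T_Pair \<Gamma>\<^sub>1 \<Delta>\<^sub>1 M A \<Gamma>\<^sub>2 \<Delta>\<^sub>2 N B)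
  have "safe_term M"
    using T_Pair.prems by (rule safe_term_subterm) (rule subterm.intros(6))
  moreover have "safe_term N"
    using T_Pair.prems by (rule safe_term_subterm) (rule subterm.intros(7))
  ultimately have "wt \<Sigma> (expvars (\<Gamma>\<^sub>1 \<union> \<Delta>\<^sub>1)) [] M A" "wt \<Sigma> (expvars (\<Gamma>\<^sub>2 \<union> \<Delta>\<^sub>2)) [] N B"
    using T_Pair.IH by auto
  then have "wt \<Sigma> (expvars (\<Gamma>\<^sub>1 \<union> \<Gamma>\<^sub>2 \<union> \<Delta>\<^sub>1 \<union> \<Delta>\<^sub>2)) [] M A"
      "wt \<Sigma> (expvars (\<Gamma>\<^sub>1 \<union> \<Gamma>\<^sub>2 \<union> \<Delta>\<^sub>1 \<union> \<Delta>\<^sub>2)) [] N B"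
    by - (erule wt_mono, auto simp: expvars_Un)+
  moreover have "bound_at i M = {}" for i
    using T_Pair.hyps(1) typing_lc_env bound_at_lc by blast
  ultimately show ?case using shared_FV[OF T_Pair.hyps(1,2)] T_Pair.hyps
    by (intro wt.wt_Pair) auto
next
  case (T_UnitL \<Delta> M B)
  then have "wt \<Sigma> (expvars \<Delta>) [] M B" by simp
  then show ?case by (rule wt_mono) (auto simp: expvars_def)
next
  case (T_PairL p q \<Delta> M C)
  then have "wt \<Sigma> (expvars (insert p (insert q \<Delta>))) [] M C" by simp
  then show ?case by (rule wt_mono) (auto simp: expvars_def)
next
  case (T_WPair \<Delta> M A N B)
  have "safe_term M"
    using T_WPair.prems by (rule safe_term_subterm) (rule subterm.intros(8))
  moreover have "safe_term N"
    using T_WPair.prems by (rule safe_term_subterm) (rule subterm.intros(9))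
  moreover have "\<forall>x\<in>FV M \<inter> FV N. ground (snd x)"
    using T_WPair.prems subterm.intros(1)[of "WPair M N"] unfolding safe_term_def by blast
  moreover have "bound_at i M = {}" for i
    using T_WPair.hyps(1) typing_lc_env bound_at_lc by blast
  ultimately show ?case using T_WPair.IH by (intro wt.wt_WPair) auto
next
  case (T_WithL1 p \<Delta> M B q)
  then have "wt \<Sigma> (expvars (insert p \<Delta>)) [] M B" by simp
  then show ?case by (rule wt_mono) (auto simp: expvars_def)
next
  case (T_WithL2 q \<Delta> M B p)
  then have "wt \<Sigma> (expvars (insert q \<Delta>)) [] M B" by simp
  then show ?case by (rule wt_mono) (auto simp: expvars_def)
qed (auto intro: wt.intros)

section \<open>The fundamental lemma\<close>

text \<open>Simultaneous substitution for all enclosing binders beyond the \<open>k\<close>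
  innermost, with one list of terms per binder. Out-of-range indices become
  \<open>Unit\<close>.\<close>

fun msub :: "nat \<Rightarrow> 'f trm list list \<Rightarrow> 'f trm \<Rightarrow> 'f trm" where
  "msub k \<sigma> (FVar x) = FVar x"
| "msub k \<sigma> (BVar i j) =
     (if i < k then BVar i j else if i - k < length \<sigma> then nth_or_unit (\<sigma> ! (i - k)) j else Unit)"
| "msub k \<sigma> (Bang M) = Bang (msub k \<sigma> M)"
| "msub k \<sigma> (Lam P M) = Lam P (msub (Suc k) \<sigma> M)"
| "msub k \<sigma> (App M N) = App (msub k \<sigma> M) (msub k \<sigma> N)"
| "msub k \<sigma> Unit = Unit"
| "msub k \<sigma> (Pair M N) = Pair (msub k \<sigma> M) (msub k \<sigma> N)"
| "msub k \<sigma> WUnit = WUnit"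
| "msub k \<sigma> (WPair M N) = WPair (msub k \<sigma> M) (msub k \<sigma> N)"
| "msub k \<sigma> (Num r) = Num r"
| "msub k \<sigma> (Fn f) = Fn f"
| "msub k \<sigma> Plus = Plus"
| "msub k \<sigma> Times = Times"

lemma msub_lcat: "lcat k M \<Longrightarrow> msub k \<sigma> M = M"
  by (induction M arbitrary: k) auto

lemma opn_msub:
  assumes "\<forall>Vs\<in>set \<sigma>. \<forall>V\<in>set Vs. lcat 0 V"
  shows "opn k Vs (msub (Suc k) \<sigma> M) = msub k (Vs # \<sigma>) M"
proof (induction M arbitrary: k)
  case (BVar i j)
  have "opn k Vs (nth_or_unit (\<sigma> ! l) j) = nth_or_unit (\<sigma> ! l) j" if "l < length \<sigma>" for l
    using assms nth_mem[OF that] by (auto simp: nth_or_unit_def opn_lcat_0)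
  then show ?case by (auto simp: nth_Cons' Suc_diff_Suc)
qed auto

lemma components_RED:
  "matches P W \<Longrightarrow> RED \<Sigma> (pat_ty P) W \<Longrightarrow>
     list_all2 (\<lambda>T V. RED \<Sigma> (snd T) V) (flagged P) (components P W)"
  by (induction P W rule: matches.induct) (auto intro!: list_all2_appendI)

lemma RED_App: "RED \<Sigma> (TLolli A B) M \<Longrightarrow> RED \<Sigma> A N \<Longrightarrow> RED \<Sigma> B (App M N)"
  by simp

lemma fundamental:
  assumes "wt \<Sigma> E G M A"
    and "list_all2 (list_all2 (\<lambda>T V. lcat 0 V \<and> RED \<Sigma> (snd T) V)) G \<sigma>"
  shows "RED \<Sigma> A (msub 0 \<sigma> M)"
  using assms
proof (induction arbitrary: \<sigma> rule: wt.induct)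
  case (wt_FVar G x)
  show ?case by (rule RED_neutral) auto
next
  case (wt_BVar i G j)
  then show ?case by (auto simp: list_all2_conv_all_nth nth_or_unit_def)
next
  case (wt_Lam P G M B)
  have \<sigma>: "\<forall>Vs\<in>set \<sigma>. \<forall>V\<in>set Vs. lcat 0 V"
    using wt_Lam.prems by (fastforce simp: list_all2_conv_all_nth in_set_conv_nth)
  have IH: "RED \<Sigma> B (opn 0 Vs (msub (Suc 0) \<sigma> M))"
    if "list_all2 (\<lambda>T V. lcat 0 V \<and> RED \<Sigma> (snd T) V) (flagged P) Vs" for Vs
    using wt_Lam.IH[of "Vs # \<sigma>"] wt_Lam.prems that by (simp add: opn_msub[OF \<sigma>])
  have "RED \<Sigma> (TLolli (pat_ty P) B) (Lam P (msub (Suc 0) \<sigma> M))"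
  proof (rule RED_Lam)
    \<comment> \<open>The body has to terminate while its bound variables are still open. Filling
      them with \<open>Unit\<close> gives a reducible term, and termination is reflected through
      opening.\<close>
    let ?Us = "replicate (length (flagged P)) Unit"
    have "RED \<Sigma> B (opn 0 ?Us (msub (Suc 0) \<sigma> M))"
      by (rule IH) (auto simp: list_all2_conv_all_nth RED_Unit)
    then show "SN \<Sigma> (msub (Suc 0) \<sigma> M)"
      by (intro SN_opn[of ?Us, OF _ RED_SN]) auto
  next
    fix W :: "'a trm" assume W: "closed_term W" "matches P W" "RED \<Sigma> (pat_ty P) W"
    show "RED \<Sigma> B (opn 0 (components P W) (msub (Suc 0) \<sigma> M))"
      using components_RED[OF W(2,3)] components_closed[OF W(2,1)]
      by (intro IH) (auto simp: list_all2_conv_all_nth closed_term_def)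
  qed
  then show ?case by simp
qed (auto simp del: RED.simps
    intro: RED_Bang RED_App RED_Pair RED_WPair RED_Unit RED_WUnit RED_Num RED_Fn RED_Plus RED_Times)

lemma wt_SN: "wt \<Sigma> E [] M A \<Longrightarrow> SN \<Sigma> M"
  using fundamental[of \<Sigma> E "[]" M A "[]"] wt_lcat[of \<Sigma> E "[]" M A] RED_SN
  by (force simp: msub_lcat)

section \<open>Progress\<close>

lemma strong_value_App: "strong_value (App M N) \<longleftrightarrow> M = Times \<and> strong_value N"
  by (cases M) auto

text \<open>The first of the canonical forms. An application that is a strong value is
  \<open>App Times V\<close>, which has an arrow type and so drops out at each of the types
  considered.\<close>

lemma value_TReal:
  "strong_value V \<Longrightarrow> FV V = {} \<Longrightarrow> wt \<Sigma> E G V TReal \<Longrightarrow> \<exists>r. V = Num r"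
  by (cases V) (auto simp: wt_simps strong_value_App)

lemma value_TOne:
  "strong_value V \<Longrightarrow> FV V = {} \<Longrightarrow> wt \<Sigma> E G V TOne \<Longrightarrow> V = Unit"
  by (cases V) (auto simp: wt_simps strong_value_App)

lemma value_TTensor:
  "strong_value V \<Longrightarrow> FV V = {} \<Longrightarrow> wt \<Sigma> E G V (TTensor A B) \<Longrightarrow>
     \<exists>V\<^sub>1 V\<^sub>2. V = Pair V\<^sub>1 V\<^sub>2 \<and> wt \<Sigma> E G V\<^sub>1 A \<and> wt \<Sigma> E G V\<^sub>2 B"
  by (cases V) (auto simp: wt_simps strong_value_App)

lemma value_TWith:
  "strong_value V \<Longrightarrow> FV V = {} \<Longrightarrow> wt \<Sigma> E G V (TWith A B) \<Longrightarrow>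
     \<exists>V\<^sub>1 V\<^sub>2. V = WPair V\<^sub>1 V\<^sub>2 \<and> wt \<Sigma> E G V\<^sub>1 A \<and> wt \<Sigma> E G V\<^sub>2 B"
  by (cases V) (auto simp: wt_simps strong_value_App)

lemma value_TBang:
  "strong_value V \<Longrightarrow> FV V = {} \<Longrightarrow> wt \<Sigma> E G V (TBang A) \<Longrightarrow>
     \<exists>V\<^sub>1. V = Bang V\<^sub>1 \<and> wt \<Sigma> E G V\<^sub>1 A"
  by (cases V) (auto simp: wt_simps strong_value_App)

lemma value_matches:
  "strong_value V \<Longrightarrow> FV V = {} \<Longrightarrow> wt \<Sigma> E G V (pat_ty P) \<Longrightarrow> matches P V"
proof (induction P arbitrary: V)
  case (PBang A)
  then show ?case using value_TBang[of V] by force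
next
  case PUnit
  then show ?case using value_TOne[of V] by force
next
  case (PPair P Q)
  then show ?case using value_TTensor[of V] by force
next
  case (PWith P Q)
  then show ?case using value_TWith[of V] by force
qed simp

lemma value_tensors:
  "strong_value V \<Longrightarrow> FV V = {} \<Longrightarrow> wt \<Sigma> E G V (tensors (replicate n (TBang TReal))) \<Longrightarrow>
     \<exists>rs. length rs = n \<and> V = tuple (map (\<lambda>r. Bang (Num r)) rs)"
proof (induction n arbitrary: V)
  case 0
  then show ?case using value_TOne[of V] by simp
next
  case (Suc n)
  show ?case
  proof (cases n)
    case 0
    then obtain W where W: "V = Bang W" "wt \<Sigma> E G W TReal"
      using Suc value_TBang[of V \<Sigma> E G TReal] by auto
    then obtain r where "W = Num r" using Suc value_TReal[of W \<Sigma> E G] by auto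
    then show ?thesis using 0 W by (intro exI[of _ "[r]"]) simp
  next
    case (Suc m)
    then have "wt \<Sigma> E G V (TTensor (TBang TReal) (tensors (replicate n (TBang TReal))))"
      using Suc.prems by simp
    then obtain V\<^sub>1 V\<^sub>2 where V: "V = Pair V\<^sub>1 V\<^sub>2" "wt \<Sigma> E G V\<^sub>1 (TBang TReal)"
        "wt \<Sigma> E G V\<^sub>2 (tensors (replicate n (TBang TReal)))"
      using value_TTensor[of V] Suc.prems by blast
    obtain W where W: "V\<^sub>1 = Bang W" "wt \<Sigma> E G W TReal"
      using V Suc.prems value_TBang[of V\<^sub>1 \<Sigma> E G TReal] by auto
    obtain r where r: "W = Num r" using V W Suc.prems value_TReal[of W \<Sigma> E G] by auto
    obtain rs where rs: "length rs = n" "V\<^sub>2 = tuple (map (\<lambda>r. Bang (Num r)) rs)"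
      using V Suc.prems Suc.IH[of V\<^sub>2] by auto
    \<comment> \<open>\<open>tuple\<close> adds a \<open>Pair\<close> in front of \<open>rs\<close>
      only if \<open>rs\<close> is nonempty.\<close>
    then obtain t ts where "rs = t # ts" using Suc by (cases rs) auto
    then show ?thesis using V W r rs by (intro exI[of _ "r # rs"]) simp
  qed
qed

lemma lc_Bang: "lc (Bang M) \<Longrightarrow> lc M"
  by (erule lc.cases) (auto simp: lam_def)

lemma lc_App: "lc (App M N) \<Longrightarrow> lc M \<and> lc N"
  by (erule lc.cases) (auto simp: lam_def)

lemma lc_Pair: "lc (Pair M N) \<Longrightarrow> lc M \<and> lc N"
  by (erule lc.cases) (auto simp: lam_def)

lemma lc_WPair: "lc (WPair M N) \<Longrightarrow> lc M \<and> lc N"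
  by (erule lc.cases) (auto simp: lam_def)

text \<open>Recovers a named pattern for a binder, as the rule \<open>safe_beta_rule\<close>
  requires.\<close>

lemma lc_Lam: "lc (Lam P M) \<Longrightarrow> \<exists>p N. Lam P M = lam p N \<and> pattern p \<and> lc N"
  by (erule lc.cases) (auto simp: lam_def)

text \<open>Presents both kinds of safe step as context closures of a rule, so that contexts are
  treated uniformly.\<close>

definition kind_rule :: "'f signature \<Rightarrow> kind \<Rightarrow> 'f trm \<Rightarrow> 'f trm \<Rightarrow> bool" where
  "kind_rule \<Sigma> k = (case k of Beta \<Rightarrow> safe_beta_rule | Numeric \<Rightarrow> numeric_rule \<Sigma>)"

lemma safe_step_ctx_closure: "safe_step \<Sigma> k = ctx_closure (kind_rule \<Sigma> k)"
  by (cases k) (simp_all add: kind_rule_def)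

lemma progress_App:
  assumes "lc (App M N)" "FV M = {}" "FV N = {}" "strong_value M" "strong_value N"
    and "wt \<Sigma> E [] (App M N) A"
  shows "strong_value (App M N) \<or> (\<exists>k L. safe_step \<Sigma> k (App M N) L)"
proof -
  have num: "\<exists>k L. safe_step \<Sigma> k (App M N) L" if "numeric_rule \<Sigma> (App M N) L" for L
    using ctx_closure.intros(1)[of "numeric_rule \<Sigma>", OF that] by (metis safe_step.simps(2))
  obtain B where wt: "wt \<Sigma> E [] M (TLolli B A)" "wt \<Sigma> E [] N B"
    using assms(6) by (auto simp: wt_simps)
  show ?thesis
  proof (cases M)
    case (Lam P M\<^sub>0)
    then obtain p M\<^sub>1 where p: "M = lam p M\<^sub>1" "P = map_pat snd p" "pattern p" "lc M\<^sub>1"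
      using lc_Lam[of P M\<^sub>0] lc_App[OF assms(1)] by (auto simp: lam_def)
    have "B = pat_ty P" using wt(1) Lam by (auto simp: wt_simps)
    then have "val p N"
      using value_matches assms wt(2) unfolding val_matches matches_map[of snd, symmetric] p(2)
      by blast
    then have "safe_beta_rule (App M N) (psubst p N M\<^sub>1)"
      using p assms lc_App[OF assms(1)] by (auto intro: safe_beta_rule.intros)
    then show ?thesis using ctx_closure.intros(1) safe_step.simps(1) by metis
  next
    case (Fn f)
    then obtain rs where "length rs = arity \<Sigma> f" "N = tuple (map (\<lambda>r. Bang (Num r)) rs)"
      using value_tensors[of N \<Sigma> E "[]" "arity \<Sigma> f"] assms wt by (auto simp: wt_simps)
    then show ?thesis using Fn num numeric_rule.intros(1) by metis
  next
    case Plus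
    then obtain V W where V: "N = WPair V W" "wt \<Sigma> E [] V TReal" "wt \<Sigma> E [] W TReal"
      using value_TWith[of N \<Sigma> E "[]" TReal TReal] assms wt by (auto simp: wt_simps)
    then obtain r s where "V = Num r" "W = Num s"
      using value_TReal[of V \<Sigma> E "[]"] value_TReal[of W \<Sigma> E "[]"] assms by auto
    then show ?thesis using Plus V num numeric_rule.intros(2) by metis
  next
    case (App M\<^sub>1 M\<^sub>2)
    then have M: "M\<^sub>1 = Times" "strong_value M\<^sub>2" using assms by (auto simp: strong_value_App)
    then have "wt \<Sigma> E [] M\<^sub>2 TReal" "wt \<Sigma> E [] N TReal"
      using wt App by (auto simp: wt_simps)
    then obtain r s where "M\<^sub>2 = Num r" "N = Num s"
      using value_TReal[of M\<^sub>2 \<Sigma> E "[]"] value_TReal[of N \<Sigma> E "[]"] assms App M by auto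
    then show ?thesis using App M num numeric_rule.intros(3) by metis
  qed (use assms wt in \<open>auto simp: wt_simps\<close>)
qed

lemma progress:
  "lc M \<Longrightarrow> FV M = {} \<Longrightarrow> wt \<Sigma> E [] M A \<Longrightarrow> strong_value M \<or> (\<exists>k N. safe_step \<Sigma> k M N)"
proof (induction arbitrary: A rule: lc.induct)
  case (2 M)
  then have "strong_value M \<or> (\<exists>k N. safe_step \<Sigma> k M N)" by (auto simp: wt_simps)
  then show ?case unfolding safe_step_ctx_closure by (auto intro: ctx_closure.intros)
next
  case (3 p M)
  then show ?case by (simp add: lam_def)
next
  case (4 M N)
  have "strong_value M \<or> (\<exists>k N. safe_step \<Sigma> k M N)" "strong_value N \<or> (\<exists>k M. safe_step \<Sigma> k N M)"
    using 4 by (auto simp: wt_simps)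
  moreover have ?case if "strong_value M" "strong_value N"
    using progress_App[of M N] 4 that by (auto intro: lc.intros)
  ultimately show ?case unfolding safe_step_ctx_closure by (blast intro: ctx_closure.intros)
next
  case (6 M N)
  have "strong_value M \<or> (\<exists>k N. safe_step \<Sigma> k M N)" "strong_value N \<or> (\<exists>k M. safe_step \<Sigma> k N M)"
    using 6 by (auto simp: wt_simps)
  then show ?case unfolding safe_step_ctx_closure strong_value.simps
    by (blast intro: ctx_closure.intros)
next
  case (8 M N)
  have "strong_value M \<or> (\<exists>k N. safe_step \<Sigma> k M N)" "strong_value N \<or> (\<exists>k M. safe_step \<Sigma> k N M)"
    using 8 by (auto simp: wt_simps)
  then show ?case unfolding safe_step_ctx_closure strong_value.simps
    by (blast intro: ctx_closure.intros)
qed auto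

section \<open>Local closure along safe steps\<close>

lemma subst_fresh: "x \<notin> FV M \<Longrightarrow> subst x N M = M"
  by (induction M) auto

lemma lc_subst: "lc M \<Longrightarrow> lc N \<Longrightarrow> FV N = {} \<Longrightarrow> lc (subst x N M)"
proof (induction rule: lc.induct)
  case (3 p M)
  show ?case
  proof (cases "x \<in> set (pvars p)")
    case True
    then show ?thesis using 3 by (auto simp: subst_fresh FV_lam intro: lc.intros)
  next
    case False
    then show ?thesis using 3 by (auto simp: subst_lam intro: lc.intros)
  qed
qed (auto intro: lc.intros)

lemma lc_psubst: "val p V \<Longrightarrow> lc V \<Longrightarrow> FV V = {} \<Longrightarrow> lc M \<Longrightarrow> lc (psubst p V M)"
  by (induction p V arbitrary: M rule: val.induct)
    (auto intro: lc_subst dest: lc_Bang lc_Pair lc_WPair)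

lemma lc_safe_step:
  assumes "safe_step \<Sigma> k M N" "lc M"
  shows "lc N"
proof -
  have "ctx_closure (kind_rule \<Sigma> k) M N" using assms(1) by (simp add: safe_step_ctx_closure)
  then show ?thesis using assms(2)
  proof (induction rule: ctx_closure.induct)
    case (1 M N)
    then show ?case
      by (cases k) (auto simp: kind_rule_def elim!: safe_beta_rule.cases numeric_rule.cases
          intro: lc_psubst lc.intros)
  qed (auto dest: lc_Bang lc_App lc_Pair lc_WPair intro: lc.intros)
qed

text \<open>A strong value of ground type contains no application at all, so no rule whose left-hand
  sides are applications can fire in it. Keeping \<open>R\<close> abstract covers the unrestricted
  beta rule.\<close>

lemma ground_value_no_step:
  assumes "ctx_closure R V N" "\<And>M N. R M N \<Longrightarrow> \<exists>M\<^sub>1 M\<^sub>2. M = App M\<^sub>1 M\<^sub>2"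
    and "strong_value V" "wt \<Sigma> E G V A" "ground A"
  shows False
  using assms(1,3-)
proof (induction arbitrary: A rule: ctx_closure.induct)
  case (1 M M')
  then show ?case using assms(2) by (fastforce simp: strong_value_App wt_simps)
qed (auto simp: strong_value_App wt_simps lam_def)

lemma ground_value_beta_normal:
  assumes "strong_value V" "wt \<Sigma> E G V A" "ground A"
  shows "beta_normal \<Sigma> V"
  unfolding beta_normal_def beta_def
proof (intro notI, elim exE)
  fix N assume "ctx_closure (\<lambda>M N. beta_rule M N \<or> numeric_rule \<Sigma> M N) V N"
  then show False
    by (rule ground_value_no_step[OF _ _ assms]) (auto elim: beta_rule.cases dest: numeric_rule_App)
qed

lemma SN_no_infinite_seq: "SN \<Sigma> M \<Longrightarrow> s 0 = M \<Longrightarrow> \<exists>i. \<not> rstep \<Sigma> (k i) (s i) (s (Suc i))"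
proof (induction arbitrary: s k rule: SN.induct)
  case (SN_I M)
  show ?case
  proof (cases "rstep \<Sigma> (k 0) M (s (Suc 0))")
    case True
    then show ?thesis using SN_I.IH[OF True, of "\<lambda>i. s (Suc i)" "\<lambda>i. k (Suc i)"] by auto
  qed (use SN_I in auto)
qed

theorem proposition1:
  fixes \<Sigma> :: "'f signature" and \<Delta> :: "var pat set" and M :: "'f trm" and A :: ty
    and n :: enat and s :: "nat \<Rightarrow> 'f trm" and k :: "nat \<Rightarrow> kind"
  assumes "wf_signature \<Sigma>"
    and "typing \<Sigma> \<Delta> M A" and "FV M = {}"
    and "safe_term M"
    and "maximal_safe_seq \<Sigma> n s k" and "s 0 = M"
  shows "\<exists>m. n = enat m \<and> strong_value (s m) \<and>
           card (numeric_steps n k) \<le> workload M \<and>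
           (ground A \<longrightarrow> beta_normal \<Sigma> (s m))"
proof -
  let ?E = "expvars \<Delta>"
  have seq: "safe_step \<Sigma> (k i) (s i) (s (Suc i))" if "enat i < n" for i
    using assms(5) that by (auto simp: maximal_safe_seq_def safe_seq_def)
  have wt: "wt \<Sigma> ?E [] M A" using typing_wt assms by blast
  obtain m where m: "n = enat m"
  proof (cases n)
    case infinity
    then show ?thesis
      using safe_step_rstep[OF seq] SN_no_infinite_seq[OF wt_SN[OF wt], of s k] assms(6) by auto
  qed
  \<comment> \<open>The workload acts as a credit: numeric steps already made plus the workload left
    never exceed the initial workload.\<close>
  have inv: "lc (s i) \<and> FV (s i) = {} \<and> wt \<Sigma> ?E [] (s i) A \<and>
      card {j. j < i \<and> k j = Numeric} + workload (s i) \<le> workload M" if "i \<le> m" for i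
    using that
  proof (induction i)
    case 0
    then show ?case using wt assms typing_lc_env[OF assms(2)] by auto
  next
    case (Suc i)
    then have step: "safe_step \<Sigma> (k i) (s i) (s (Suc i))" using seq m by simp
    note r = safe_step_rstep[OF step]
    have "{j. j < Suc i \<and> k j = Numeric} =
        (if k i = Numeric then insert i {j. j < i \<and> k j = Numeric} else {j. j < i \<and> k j = Numeric})"
      by (auto simp: less_Suc_eq)
    then have "card {j. j < Suc i \<and> k j = Numeric} =
        card {j. j < i \<and> k j = Numeric} + (if k i = Numeric then 1 else 0)"
      by simp
    then show ?case using Suc lc_safe_step[OF step] rstep_FV[OF r] wt_rstep[OF r, of ?E "[]" A]
      by auto
  qed
  have "strong_value (s m)"
    using inv[of m] progress[of "s m" \<Sigma> ?E A] assms(5) m by (auto simp: maximal_safe_seq_def)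
  moreover have "card (numeric_steps n k) \<le> workload M"
    using inv[of m] m by (simp add: numeric_steps_def)
  ultimately show ?thesis using m inv[of m] ground_value_beta_normal by blast
qed

end
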